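(* Let $\mathbf{Z}\in L^{\infty-}(\Omega,\mathcal{F},\mathbb{P})\otimes \mathrm{M}_d(\mathcal{A})$ be a selfadjoint centered random operator-valued matrix. Suppose that $\{\mathbf{Z}^{(n)}\}_{n\ge 1}$ are independent and free over $\mathrm{M}_d(\mathbb{C})$ copies of $\mathbf{Z}$. Then the normalized sum $\mathbf{S}_N=\dfrac{\mathbf{Z}^{(1)}+\cdots+\mathbf{Z}^{(N)}}{\sqrt{N}}$ satisfies $$\lim_{N\to\infty}\mathbb{E}\big(E(\mathbf{S}_N^m)\big)=\sum_{\pi\in \mathrm{NC}_2(m)}\hat{\kappa}_\pi(\mathbf{Z})$$ for all $m\in\mathbb{N}$, where $\hat\kappa_\pi(\mathbf{Z})$ is defined recursively from the nested structure of $\pi$ using the map $\hat\eta:\mathrm{M}_d(\mathbb{C})\to\mathrm{M}_d(\mathbb{C})$, $\hat\eta(B)=\mathbb{E}(E(\mathbf{Z}B\mathbf{Z}))$.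
   Context: $d$ is a fixed positive integer; $(\Omega,\mathcal{F},\mathbb{P})$ is a probability space with expectation $\mathbb{E}$; $L^{\infty-}(\Omega,\mathcal{F},\mathbb{P})=\bigcap_{1\le p<\infty}L^p(\Omega,\mathcal{F},\mathbb{P})$ (complex-valued); $(\mathcal{A},\varphi)$ is a non-commutative ($*$-)probability space. $E=\mathrm{I}\otimes\varphi:\mathrm{M}_d(\mathcal{A})\to\mathrm{M}_d(\mathbb{C})$ applies $\varphi$ entrywise. Elements of the algebraic tensor product $L^{\infty-}(\Omega,\mathcal{F},\mathbb{P})\otimes\mathrm{M}_d(\mathcal{A})$ are called random operator-valued matrices; each is a finite sum $\sum_{i=1}^n a_i\otimes\mathbf{Z}_i$ with $a_i\in L^{\infty-}$ and $\mathbf{Z}_i\in\mathrm{M}_d(\mathcal{A})$. The maps $E$ and $\mathbb{E}$ are extended by $E(\sum a_i\otimes \mathbf{Z}_i)=\sum a_iE(\mathbf{Z}_i)$ (a random matrix) and $\mathbb{E}(\sum a_i\otimes\mathbf{Z}_i)=\sum\mathbb{E}(a_i)\mathbf{Z}_i$; $\mathrm{M}_d(\mathbb{C})$ is included in this algebra as $1\otimes \mathrm{M}_d(\mathbb{C}1_{\mathcal{A}})$. Centered: $\mathbf{Z}$ is centered if it can be written $\mathbf{Z}=\sum_{i=1}^n a_i\otimes\mathbf{Z}_i$ with $E(\mathbf{Z}_i)=0$ for all $i$. Freeness over $\mathrm{M}_d(\mathbb{C})$: families in $\mathrm{M}_d(\mathcal{A})$ are free over $\mathrm{M}_d(\mathbb{C})$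 if $E(P_1P_2\cdots P_k)=0$ whenever $k\in\mathbb{N}$, each $P_j$ is a non-commutative polynomial with coefficients in $\mathrm{M}_d(\mathbb{C})$ (coefficients not commuting with the variables) in the elements of the $i_j$-th family, $E(P_j)=0$ for all $j$, and $i_j\ne i_{j+1}$ for all $1\le j<k$. Independent and free copies: write $\mathbf{Z}=\sum_{i=1}^n a_i\otimes\mathbf{Z}_i$. Independent and free over $\mathrm{M}_d(\mathbb{C})$ copies of $\mathbf{Z}$ are $\mathbf{Z}^{(j)}=\sum_{i=1}^n a_i^{(j)}\otimes\mathbf{Z}_i^{(j)}$, $j\ge1$, where $\{a_1^{(j)},\dots,a_n^{(j)}\}_j$ are independent identically distributed copies of the family $\{a_1,\dots,a_n\}$, and $\{\mathbf{Z}_1^{(j)},\dots,\mathbf{Z}_n^{(j)}\}_j$ are copies of $\{\mathbf{Z}_1,\dots,\mathbf{Z}_n\}$ (same joint $\mathrm{M}_d(\mathbb{C})$-valued distribution: $E$ of any non-commutative polynomial with coefficients in $\mathrm{M}_d(\mathbb{C})$ is the same) that are free over $\mathrm{M}_d(\mathbb{C})$ (the spaces being enlarged if necessary so that they exist). $\mathrm{NC}_2(m)$ is the set of non-crossing pairings of $\{1,\dots,m\}$ (empty if $m$ is odd). Given a linear map $\eta$ on $\mathrm{M}_d(\mathbb{C})$, $\kappa_\pi$ is defined recursively by $\kappa_\emptyset=\mathrm{I}$ and, if $1$ is paired with $k$ in $\pi$, $\kappa_\pi=\eta(\kappa_{\pi'})\,\kappa_{\pi''}$, where $\pi'$ and $\pi''$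 are the restrictions of $\pi$ to $\{2,\dots,k-1\}$ and $\{k+1,\dots,m\}$ (e.g. $\pi=\{(1,6),(2,3),(4,5),(7,8)\}$ gives $\eta(\eta(\mathrm{I})\eta(\mathrm{I}))\eta(\mathrm{I})$). $\hat\kappa_\pi(\mathbf{Z})$ is this quantity with $\eta=\hat\eta$. *)

theory Defs
  imports "HOL-Probability.Probability"
begin

section \<open>Non-commutative probability spaces\<close>

text \<open>Unital complex \<open>*\<close>-algebras. The axiom \<open>0 \<noteq> 1\<close> of \<open>ring_1\<close> is no restriction in
  the presence of a unital functional.\<close>

class star_algebra = ring_1 +
  fixes scaleC :: "complex \<Rightarrow> 'a \<Rightarrow> 'a" (infixr "*\<^sub>C" 75)
    and star :: "'a \<Rightarrow> 'a"
  assumes scaleC_add_right: "c *\<^sub>C (x + y) = c *\<^sub>C x + c *\<^sub>C y"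
    and scaleC_add_left: "(b + c) *\<^sub>C x = b *\<^sub>C x + c *\<^sub>C x"
    and scaleC_scaleC: "b *\<^sub>C (c *\<^sub>C x) = (b * c) *\<^sub>C x"
    and scaleC_one: "1 *\<^sub>C x = x"
    and mult_scaleC_left: "(c *\<^sub>C x) * y = c *\<^sub>C (x * y)"
    and mult_scaleC_right: "x * (c *\<^sub>C y) = c *\<^sub>C (x * y)"
    and star_add: "star (x + y) = star x + star y"
    and star_scaleC: "star (c *\<^sub>C x) = cnj c *\<^sub>C star x"
    and star_mult: "star (x * y) = star y * star x"
    and star_star: "star (star x) = x"

locale star_prob_space =
  fixes \<phi> :: "'a::star_algebra \<Rightarrow> complex"
  assumes state_add: "\<phi> (x + y) = \<phi> x + \<phi> y"
    and state_scaleC: "\<phi> (c *\<^sub>C x) = c * \<phi> x"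
    and state_one: "\<phi> 1 = 1"
    and state_pos: "\<phi> (star x * x) \<in> \<real>\<^sub>\<ge>\<^sub>0"

section \<open>Matrices over a non-commutative probability space\<close>

definition mscale :: "complex \<Rightarrow> 'a::star_algebra ^'d^'d \<Rightarrow> 'a^'d^'d" where
  "mscale c X = (\<chi> i j. c *\<^sub>C (X $ i $ j))"

definition madj :: "'a::star_algebra ^'d^'d \<Rightarrow> 'a^'d^'d" where
  "madj X = (\<chi> i j. star (X $ j $ i))"

definition membed :: "complex ^'d^'d \<Rightarrow> 'a::star_algebra ^'d^'d" where
  "membed B = (\<chi> i j. (B $ i $ j) *\<^sub>C 1)"

primrec mpow :: "'a::semiring_1 ^'d^'d \<Rightarrow> nat \<Rightarrow> 'a^'d^'d" where
  "mpow X 0 = mat 1"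
| "mpow X (Suc m) = X ** mpow X m"

definition op_exp :: "('a \<Rightarrow> complex) \<Rightarrow> 'a^'d^'d \<Rightarrow> complex ^'d^'d" where
  "op_exp \<phi> X = (\<chi> i j. \<phi> (X $ i $ j))"

text \<open>Non-commutative polynomials with matrix coefficients; coefficients do not commute with the
  variables. They are expressions here, and only their evaluations are used.\<close>

datatype (dead 'c, ncvars: 'v) ncpoly =
  NCoeff 'c
| NVar 'v
| NAdd "('c, 'v) ncpoly" "('c, 'v) ncpoly"
| NMul "('c, 'v) ncpoly" "('c, 'v) ncpoly"

primrec nceval :: "('v \<Rightarrow> 'a::star_algebra ^'d^'d) \<Rightarrow> (complex ^'d^'d, 'v) ncpoly \<Rightarrow> 'a^'d^'d" where
  "nceval X (NCoeff B) = membed B"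
| "nceval X (NVar v) = X v"
| "nceval X (NAdd p q) = nceval X p + nceval X q"
| "nceval X (NMul p q) = nceval X p ** nceval X q"

text \<open>The families \<open>{X j i | i \<in> I}\<close>, for \<open>j \<in> J\<close>, are free over the scalar matrices.\<close>

definition free_families ::
    "('a::star_algebra \<Rightarrow> complex) \<Rightarrow> 'j set \<Rightarrow> 'v set \<Rightarrow> ('j \<Rightarrow> 'v \<Rightarrow> 'a^'d^'d) \<Rightarrow> bool" where
  "free_families \<phi> J I X \<longleftrightarrow>
     (\<forall>w :: ('j \<times> (complex ^'d^'d, 'v) ncpoly) list.
        w \<noteq> [] \<longrightarrow>
        (\<forall>(j, p) \<in> set w. j \<in> J \<and> ncvars p \<subseteq> I \<and> op_exp \<phi> (nceval (X j) p) = 0) \<longrightarrow>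
        successively (\<noteq>) (map fst w) \<longrightarrow>
        op_exp \<phi> (foldr (**) (map (\<lambda>(j, p). nceval (X j) p) w) (mat 1)) = 0)"

definition same_op_distr ::
    "('a::star_algebra \<Rightarrow> complex) \<Rightarrow> ('b::star_algebra \<Rightarrow> complex) \<Rightarrow> 'v set \<Rightarrow>
     ('v \<Rightarrow> 'a^'d^'d) \<Rightarrow> ('v \<Rightarrow> 'b^'d^'d) \<Rightarrow> bool" where
  "same_op_distr \<phi> \<psi> I X Y \<longleftrightarrow>
     (\<forall>p :: (complex ^'d^'d, 'v) ncpoly. ncvars p \<subseteq> I \<longrightarrow>
        op_exp \<phi> (nceval X p) = op_exp \<psi> (nceval Y p))"

section \<open>Random operator-valued matrices\<close>

definition Linf_minus :: "'w measure \<Rightarrow> ('w \<Rightarrow> complex) set" where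
  "Linf_minus M = {f \<in> borel_measurable M. \<forall>p::real. p \<ge> 1 \<longrightarrow> integrable M (\<lambda>\<omega>. cmod (f \<omega>) powr p)}"

text \<open>The algebraic tensor product of \<open>L\<^sup>\<infinity>\<^sup>-\<close> and the matrix algebra is realised by matrix-valued
  functions on the probability space: \<open>a\<^sub>1 \<otimes> X\<^sub>1 + \<dots> + a\<^sub>n \<otimes> X\<^sub>n\<close> is the function
  \<open>\<omega> \<mapsto> a\<^sub>1(\<omega>) X\<^sub>1 + \<dots> + a\<^sub>n(\<omega>) X\<^sub>n\<close>, and equality in the tensor product is equality almost
  everywhere. Lemma \<open>tensor_realisation_faithful\<close> below shows that no further identification is
  made. Product, adjoint and the conditional expectation \<open>E\<close> act pointwise.\<close>

definition tsum ::
    "nat \<Rightarrow> (nat \<Rightarrow> 'w \<Rightarrow> complex) \<Rightarrow> (nat \<Rightarrow> 'a::star_algebra ^'d^'d) \<Rightarrow> 'w \<Rightarrow> 'a^'d^'d" where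
  "tsum n a X = (\<lambda>\<omega>. \<Sum>i = 1..n. mscale (a i \<omega>) (X i))"

definition random_op_matrices :: "'w measure \<Rightarrow> ('w \<Rightarrow> 'a::star_algebra ^'d^'d) set" where
  "random_op_matrices M = {tsum n a X | n a X. \<forall>i\<in>{1..n}. a i \<in> Linf_minus M}"

definition teq :: "'w measure \<Rightarrow> ('w \<Rightarrow> 'c) \<Rightarrow> ('w \<Rightarrow> 'c) \<Rightarrow> bool" where
  "teq M Z W \<longleftrightarrow> (AE \<omega> in M. Z \<omega> = W \<omega>)"

definition selfadjoint_rom :: "'w measure \<Rightarrow> ('w \<Rightarrow> 'a::star_algebra ^'d^'d) \<Rightarrow> bool" where
  "selfadjoint_rom M Z \<longleftrightarrow> teq M (\<lambda>\<omega>. madj (Z \<omega>)) Z"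

definition centered_rom ::
    "'w measure \<Rightarrow> ('a::star_algebra \<Rightarrow> complex) \<Rightarrow> ('w \<Rightarrow> 'a^'d^'d) \<Rightarrow> bool" where
  "centered_rom M \<phi> Z \<longleftrightarrow>
     (\<exists>n a X. (\<forall>i\<in>{1..n}. a i \<in> Linf_minus M \<and> op_exp \<phi> (X i) = 0) \<and> teq M Z (tsum n a X))"

text \<open>The expectation (entrywise) of the random matrix \<open>E(Z)\<close>.\<close>

definition total_exp ::
    "'w measure \<Rightarrow> ('a \<Rightarrow> complex) \<Rightarrow> ('w \<Rightarrow> 'a^'d^'d) \<Rightarrow> complex ^'d^'d" where
  "total_exp M \<phi> Z = (\<chi> i j. prob_space.expectation M (\<lambda>\<omega>. op_exp \<phi> (Z \<omega>) $ i $ j))"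

text \<open>Independent and free copies \<open>Zs 1, Zs 2, \<dots>\<close> of \<open>Z\<close>. They live over probability spaces
  \<open>(M', \<phi>')\<close> that may differ from \<open>(M, \<phi>)\<close>, which covers any enlargement. The representation of
  \<open>Z\<close> from which the copies are built is arbitrary.\<close>

definition indep_free_copies ::
    "'w measure \<Rightarrow> ('a::star_algebra \<Rightarrow> complex) \<Rightarrow> ('w \<Rightarrow> 'a^'d^'d) \<Rightarrow>
     'v measure \<Rightarrow> ('b::star_algebra \<Rightarrow> complex) \<Rightarrow> (nat \<Rightarrow> 'v \<Rightarrow> 'b^'d^'d) \<Rightarrow> bool" where
  "indep_free_copies M \<phi> Z M' \<phi>' Zs \<longleftrightarrow>
     (\<exists>n a X a' X'.
        (\<forall>i\<in>{1..n}. a i \<in> Linf_minus M) \<and>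
        teq M Z (tsum n a X) \<and>
        (\<forall>j\<ge>1. \<forall>i\<in>{1..n}. a' j i \<in> Linf_minus M') \<and>
        (\<forall>j\<ge>1. Zs j \<in> random_op_matrices M' \<and> teq M' (Zs j) (tsum n (a' j) (X' j))) \<and>
        prob_space.indep_vars M' (\<lambda>_. Pi\<^sub>M {1..n} (\<lambda>_. borel))
          (\<lambda>j \<omega>. \<lambda>i\<in>{1..n}. a' j i \<omega>) {1..} \<and>
        (\<forall>j\<ge>1. distr M' (Pi\<^sub>M {1..n} (\<lambda>_. borel)) (\<lambda>\<omega>. \<lambda>i\<in>{1..n}. a' j i \<omega>) =
                distr M (Pi\<^sub>M {1..n} (\<lambda>_. borel)) (\<lambda>\<omega>. \<lambda>i\<in>{1..n}. a i \<omega>)) \<and>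
        (\<forall>j\<ge>1. same_op_distr \<phi>' \<phi> {1..n} (X' j) X) \<and>
        free_families \<phi>' {1..} {1..n} X')"

definition normalized_sum :: "(nat \<Rightarrow> 'w \<Rightarrow> 'a::star_algebra ^'d^'d) \<Rightarrow> nat \<Rightarrow> 'w \<Rightarrow> 'a^'d^'d" where
  "normalized_sum Zs N = (\<lambda>\<omega>. mscale (complex_of_real (1 / sqrt (real N))) (\<Sum>j = 1..N. Zs j \<omega>))"

section \<open>Non-crossing pairings\<close>

definition NC2 :: "nat \<Rightarrow> nat set set set" where
  "NC2 m = {\<pi>. partition_on {1..m} \<pi> \<and> (\<forall>b\<in>\<pi>. card b = 2) \<and>
     \<not> (\<exists>a b c d. a < b \<and> b < c \<and> c < d \<and> {a, c} \<in> \<pi> \<and> {b, d} \<in> \<pi>)}"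

text \<open>The recursion is on the set of blocks: \<open>l\<close> is the first point of the ground set and \<open>k\<close> its
  partner. The guard is only there to make the function total; for a pairing it fails exactly when
  the pairing is empty. No relabelling to \<open>{1..m}\<close> is needed.\<close>

function kappa :: "(complex ^'d^'d \<Rightarrow> complex ^'d^'d) \<Rightarrow> nat set set \<Rightarrow> complex ^'d^'d" where
  "kappa \<eta> \<pi> =
     (let l = Min (\<Union>\<pi>); k = (THE k. {l, k} \<in> \<pi>) in
      if finite \<pi> \<and> {l, k} \<in> \<pi>
      then \<eta> (kappa \<eta> {b \<in> \<pi>. b \<subseteq> {l<..<k}}) ** kappa \<eta> {b \<in> \<pi>. b \<subseteq> {k<..}}
      else mat 1)"
  by auto
termination
proof (relation "Wellfounded.measure (\<lambda>(\<eta>, \<pi>). card \<pi>)")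
  have less: "card {b \<in> \<pi>. b \<subseteq> S} < card \<pi>"
    if "finite \<pi>" "x \<in> \<pi>" "\<not> x \<subseteq> S" for \<pi> :: "nat set set" and x S
    using that by (intro psubset_card_mono) auto
  fix \<eta> :: "complex ^'d^'d \<Rightarrow> complex ^'d^'d" and \<pi> :: "nat set set" and l k
  assume "finite \<pi> \<and> {l, k} \<in> \<pi>"
  then show "((\<eta>, {b \<in> \<pi>. b \<subseteq> {l<..<k}}), (\<eta>, \<pi>)) \<in> Wellfounded.measure (\<lambda>(\<eta>, \<pi>). card \<pi>)"
    and "((\<eta>, {b \<in> \<pi>. b \<subseteq> {k<..}}), (\<eta>, \<pi>)) \<in> Wellfounded.measure (\<lambda>(\<eta>, \<pi>). card \<pi>)"
    using less[of \<pi> "{l, k}"] by auto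
qed simp

declare kappa.simps [simp del]

section \<open>Faithfulness of the realisation of the tensor product\<close>

lemma scaleC_zero_left [simp]: "0 *\<^sub>C (x::'a::star_algebra) = 0"
  using scaleC_add_left[of 0 0 x] by simp

lemma scaleC_zero_right [simp]: "c *\<^sub>C (0::'a::star_algebra) = 0"
  using scaleC_add_right[of c 0 0] by simp

lemma mscale_simps:
  "mscale c (X + Y) = mscale c X + mscale c Y"
  "mscale (b + c) X = mscale b X + mscale c X"
  "mscale b (mscale c X) = mscale (b * c) X"
  "mscale 1 X = X" "mscale 0 X = 0" "mscale c 0 = 0"
  by (simp_all add: mscale_def vec_eq_iff scaleC_add_left scaleC_add_right scaleC_scaleC scaleC_one)

lemma mscale_sum: "mscale c (\<Sum>i\<in>I. f i) = (\<Sum>i\<in>I. mscale c (f i))"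
  by (induction I rule: infinite_finite_induct) (simp_all add: mscale_simps)

lemma Linf_minus_add:
  assumes "f \<in> Linf_minus M" "g \<in> Linf_minus M"
  shows "(\<lambda>\<omega>. f \<omega> + g \<omega>) \<in> Linf_minus M"
proof -
  have [measurable]: "f \<in> borel_measurable M" "g \<in> borel_measurable M"
    using assms by (auto simp: Linf_minus_def)
  have "integrable M (\<lambda>\<omega>. cmod (f \<omega> + g \<omega>) powr p)" if p: "p \<ge> 1" for p :: real
  proof (rule Bochner_Integration.integrable_bound)
    show "integrable M (\<lambda>\<omega>. 2 powr p * (cmod (f \<omega>) powr p + cmod (g \<omega>) powr p))"
      using assms p by (auto simp: Linf_minus_def)
    show "AE \<omega> in M. norm (cmod (f \<omega> + g \<omega>) powr p)
        \<le> norm (2 powr p * (cmod (f \<omega>) powr p + cmod (g \<omega>) powr p))"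
    proof (rule AE_I2)
      fix \<omega>
      let ?m = "max (cmod (f \<omega>)) (cmod (g \<omega>))"
      have "cmod (f \<omega> + g \<omega>) \<le> 2 * ?m"
        using norm_triangle_ineq[of "f \<omega>" "g \<omega>"] by linarith
      then have "cmod (f \<omega> + g \<omega>) powr p \<le> (2 * ?m) powr p"
        using p by (intro powr_mono2) auto
      also have "\<dots> = 2 powr p * ?m powr p"
        by (simp add: powr_mult)
      also have "?m powr p \<le> cmod (f \<omega>) powr p + cmod (g \<omega>) powr p"
        by (simp add: max_def)
      finally show "norm (cmod (f \<omega> + g \<omega>) powr p)
          \<le> norm (2 powr p * (cmod (f \<omega>) powr p + cmod (g \<omega>) powr p))"
        by simp
    qed
  qed simp
  then show ?thesis
    by (simp add: Linf_minus_def)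
qed

lemma Linf_minus_mult_const:
  assumes "f \<in> Linf_minus M"
  shows "(\<lambda>\<omega>. c * f \<omega>) \<in> Linf_minus M"
  using assms by (auto simp: Linf_minus_def norm_mult powr_mult)

text \<open>A formal sum that vanishes as a function is annihilated by every balanced biadditive map
  on \<open>L\<^sup>\<infinity>\<^sup>-\<close> (functions modulo null sets) and the matrix algebra; hence it is zero in the algebraic
  tensor product.\<close>

lemma tensor_realisation_faithful:
  fixes \<beta> :: "('w \<Rightarrow> complex) \<Rightarrow> 'a::star_algebra ^'d^'d \<Rightarrow> 'v::ab_group_add"
  assumes add_left: "\<And>f g X. f \<in> Linf_minus M \<Longrightarrow> g \<in> Linf_minus M \<Longrightarrow>
        \<beta> (\<lambda>\<omega>. f \<omega> + g \<omega>) X = \<beta> f X + \<beta> g X"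
    and add_right: "\<And>f X Y. f \<in> Linf_minus M \<Longrightarrow> \<beta> f (X + Y) = \<beta> f X + \<beta> f Y"
    and balanced: "\<And>f c X. f \<in> Linf_minus M \<Longrightarrow> \<beta> (\<lambda>\<omega>. c * f \<omega>) X = \<beta> f (mscale c X)"
    and null: "\<And>f X. f \<in> Linf_minus M \<Longrightarrow> AE \<omega> in M. f \<omega> = 0 \<Longrightarrow> \<beta> f X = 0"
    and a: "\<And>i. i \<in> {1..n} \<Longrightarrow> a i \<in> Linf_minus M"
    and zero: "teq M (tsum n a X) (\<lambda>_. 0)"
  shows "(\<Sum>i = 1..n. \<beta> (a i) (X i)) = 0"
  using a zero
proof (induction n arbitrary: a)
  case 0
  then show ?case by simp
next
  case (Suc n)
  let ?b = "a (Suc n)" and ?Y = "X (Suc n)"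
  have b: "?b \<in> Linf_minus M" and a: "\<And>i. i \<in> {1..n} \<Longrightarrow> a i \<in> Linf_minus M"
    using Suc.prems(1) by auto
  have zero: "AE \<omega> in M. (\<Sum>i = 1..n. mscale (a i \<omega>) (X i)) + mscale (?b \<omega>) ?Y = 0"
    using Suc.prems(2) by (simp add: teq_def tsum_def)
  have beta_zero: "\<beta> ?b 0 = 0"
    using add_right[OF b, of 0 0] by simp
  have beta_sum: "\<beta> ?b (\<Sum>i\<in>I. f i) = (\<Sum>i\<in>I. \<beta> ?b (f i))" for I :: "nat set" and f
    by (induction I rule: infinite_finite_induct) (simp_all add: beta_zero add_right[OF b])
  show ?case
  proof (cases "\<exists>c. ?Y = (\<Sum>i = 1..n. mscale (c i) (X i))")
    case True
    then obtain c where Y: "?Y = (\<Sum>i = 1..n. mscale (c i) (X i))" by blast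
    define a' where "a' = (\<lambda>i \<omega>. a i \<omega> + c i * ?b \<omega>)"
    have a': "a' i \<in> Linf_minus M" if "i \<in> {1..n}" for i
      unfolding a'_def by (intro Linf_minus_add Linf_minus_mult_const a b that)
    have "tsum n a' X \<omega> = (\<Sum>i = 1..n. mscale (a i \<omega>) (X i)) + mscale (?b \<omega>) ?Y" for \<omega>
      by (simp add: tsum_def a'_def Y mscale_sum mscale_simps sum.distrib mult.commute)
    then have "teq M (tsum n a' X) (\<lambda>_. 0)"
      using zero by (simp add: teq_def)
    from Suc.IH[OF a' this] have "(\<Sum>i = 1..n. \<beta> (a' i) (X i)) = 0" by blast
    moreover have "\<beta> (a' i) (X i) = \<beta> (a i) (X i) + \<beta> ?b (mscale (c i) (X i))"
      if "i \<in> {1..n}" for i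
      unfolding a'_def
      by (simp only: add_left[OF a[OF that] Linf_minus_mult_const[OF b]] balanced[OF b])
    ultimately show ?thesis
      by (simp add: Y beta_sum sum.distrib)
  next
    case False
    have "?b \<omega> = 0" if "(\<Sum>i = 1..n. mscale (a i \<omega>) (X i)) + mscale (?b \<omega>) ?Y = 0" for \<omega>
    proof (rule ccontr)
      assume nz: "?b \<omega> \<noteq> 0"
      have "mscale (?b \<omega>) ?Y + (\<Sum>i = 1..n. mscale (a i \<omega>) (X i)) = 0"
        using that by (simp add: add.commute)
      moreover have "mscale (-1) W + W = 0" for W :: "'a^'d^'d"
        using mscale_simps(2)[of "-1" 1 W] by (simp add: mscale_simps)
      ultimately have "mscale (?b \<omega>) ?Y = mscale (-1) (\<Sum>i = 1..n. mscale (a i \<omega>) (X i))"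
        by (metis add_right_imp_eq)
      then have "mscale (inverse (?b \<omega>)) (mscale (?b \<omega>) ?Y)
          = (\<Sum>i = 1..n. mscale (inverse (?b \<omega>) * (-1 * a i \<omega>)) (X i))"
        by (simp add: mscale_sum mscale_simps)
      then have "?Y = (\<Sum>i = 1..n. mscale (inverse (?b \<omega>) * (-1 * a i \<omega>)) (X i))"
        using nz by (simp add: mscale_simps)
      then have "\<exists>c. ?Y = (\<Sum>i = 1..n. mscale (c i) (X i))"
        by (rule exI[where x = "\<lambda>i. inverse (?b \<omega>) * (-1 * a i \<omega>)"])
      with False show False by blast
    qed
    then have b0: "AE \<omega> in M. ?b \<omega> = 0"
      using zero by auto
    have "teq M (tsum n a X) (\<lambda>_. 0)"
      using zero b0 unfolding teq_def tsum_def
      by eventually_elim (simp add: mscale_simps)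
    from Suc.IH[OF a this] null[OF b b0] show ?thesis by simp
  qed
qed

end

theory Submission
  imports Defs
begin

text \<open>Write \<open>S\<^sub>N = N\<^sup>-\<^sup>1\<^sup>/\<^sup>2 \<Sum>\<^sub>j \<Sum>\<^sub>i a\<^sub>j\<^sub>i \<otimes> Y\<^sub>j\<^sub>i\<close>, where the matrices \<open>Y\<^sub>j\<^sub>i\<close> are centred. The \<open>m\<close>-th moment is then
\<open>N\<^sup>-\<^sup>m\<^sup>/\<^sup>2\<close> times a sum over words of length \<open>m\<close> in the letters \<open>(j, i)\<close>; the contribution of a word is
its classical moment, a product over the occurring \<open>j\<close> by independence, times its operator-valued
moment, which freeness determines.

Two facts decide which words survive. A word in which some \<open>j\<close> occurs exactly once contributes
zero (\<open>op_moment_singleton\<close>). A word whose indices all occur at least twice, and one of them more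
often, uses fewer than \<open>m / 2\<close> distinct indices; there are only \<open>O(N\<^sup>(\<^sup>m\<^sup>-\<^sup>1\<^sup>)\<^sup>/\<^sup>2)\<close> of these words, and their
contributions are bounded uniformly because a contribution does not change when indices are
renamed injectively (\<open>moment_relabel\<close>). So only the words matter in which every index occurs exactly
twice.

These pair words are summed exactly. Split at the second occurrence of its first index, the word is
\<open>(j, i) u (j, i') v\<close>, and freeness gives \<open>E(Y\<^sub>j\<^sub>i E(u) Y\<^sub>j\<^sub>i\<^sub>') E(v)\<close> (\<open>free_nested_pair\<close>). If \<open>u\<close> and \<open>v\<close> share an
index, that index occurs only once in \<open>u\<close>, so \<open>E(u) = 0\<close>: this is how crossings disappear. Otherwise
the classical moment factorises as well, and summing over \<open>i, i'\<close> produces \<open>\<eta>\<close>. Hence, for even \<open>m\<close>,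
the sum over pair words with indices in a set of size \<open>N\<close> is \<open>N (N - 1) \<dots> (N - m/2 + 1) c\<^sub>m\<close>, where
\<open>c\<^sub>0 = 1\<close> and \<open>c\<^sub>m\<^sub>+\<^sub>2 = \<Sum>\<^sub>k \<eta>(c\<^sub>k) c\<^sub>m\<^sub>-\<^sub>k\<close>; for odd \<open>m\<close> there are no pair words (\<open>sum_moment_pair_words\<close>). Cutting a
non-crossing pairing at the partner of its first point shows that the sums of \<open>\<kappa>\<^sub>\<pi>\<close> satisfy the same
recursion (\<open>sum_kappa_NC2\<close>), and \<open>N (N - 1) \<dots> (N - m/2 + 1)\<close> divided by \<open>N\<^sup>m\<^sup>/\<^sup>2\<close> tends to \<open>1\<close>.\<close>

section \<open>Scalar matrices and the conditional expectation\<close>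

definition cscale :: "complex \<Rightarrow> complex ^'d^'d \<Rightarrow> complex ^'d^'d" where
  "cscale c B = (\<chi> i j. c * B $ i $ j)"

lemma cscale_simps:
  "cscale c (A + B) = cscale c A + cscale c B"
  "cscale (b + c) A = cscale b A + cscale c A"
  "cscale b (cscale c A) = cscale (b * c) A"
  "cscale 1 A = A" "cscale 0 A = 0" "cscale c 0 = 0"
  "cscale c A ** B = cscale c (A ** B)"
  "A ** cscale c B = cscale c (A ** B)"
  by (simp_all add: cscale_def vec_eq_iff matrix_matrix_mult_def sum_distrib_left algebra_simps)

lemma cscale_sum: "cscale c (\<Sum>i\<in>I. f i) = (\<Sum>i\<in>I. cscale c (f i))"
  by (induction I rule: infinite_finite_induct) (simp_all add: cscale_simps)

lemma cscale_of_real: "cscale (complex_of_real r) A = r *\<^sub>R A"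
  by (simp add: cscale_def vec_eq_iff scaleR_conv_of_real[where 'a = complex])

lemma matrix_mult_zero [simp]:
  fixes X :: "'a::semiring_1 ^'d^'d"
  shows "X ** 0 = 0" "0 ** X = 0"
  by (simp_all add: matrix_matrix_mult_def vec_eq_iff)

lemma matrix_add_rdistrib:
  fixes X :: "'a::semiring_1 ^'d^'d"
  shows "(A + B) ** X = A ** X + B ** X"
  by (simp add: matrix_matrix_mult_def vec_eq_iff distrib_right sum.distrib)

lemma matrix_mult_sum:
  fixes X :: "'a::semiring_1 ^'d^'d"
  shows "X ** (\<Sum>i\<in>I. f i) = (\<Sum>i\<in>I. X ** f i)" "(\<Sum>i\<in>I. f i) ** X = (\<Sum>i\<in>I. f i ** X)"
  by (induction I rule: infinite_finite_induct)
    (simp_all add: matrix_add_ldistrib matrix_add_rdistrib)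

lemma scaleC_sum_right: "c *\<^sub>C (\<Sum>i\<in>I. f i) = (\<Sum>i\<in>I. c *\<^sub>C f i)"
  by (induction I rule: infinite_finite_induct) (simp_all add: scaleC_add_right)

lemma mscale_mult: "mscale c X ** Y = mscale c (X ** Y)" "X ** mscale c Y = mscale c (X ** Y)"
  by (simp_all add: mscale_def vec_eq_iff matrix_matrix_mult_def scaleC_sum_right
      mult_scaleC_left mult_scaleC_right)

lemma membed_simps:
  "membed (A + B) = membed A + membed B"
  "membed 0 = 0"
  "membed (cscale c A) = mscale c (membed A)"
  by (simp_all add: membed_def cscale_def mscale_def vec_eq_iff scaleC_add_left scaleC_scaleC)

lemma membed_one: "membed (mat 1) = mat 1"
  by (auto simp: membed_def mat_def vec_eq_iff scaleC_one)

lemma membed_uminus: "membed A + membed (- A) = 0"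
  by (simp flip: membed_simps(1) add: membed_simps)

context star_prob_space
begin

lemma state_zero: "\<phi> 0 = 0"
  using state_add[of 0 0] by simp

lemma state_sum: "\<phi> (\<Sum>i\<in>I. f i) = (\<Sum>i\<in>I. \<phi> (f i))"
  by (induction I rule: infinite_finite_induct) (simp_all add: state_zero state_add)

lemma op_exp_add: "op_exp \<phi> (X + Y) = op_exp \<phi> X + op_exp \<phi> Y"
  by (simp add: op_exp_def vec_eq_iff state_add)

lemma op_exp_zero [simp]: "op_exp \<phi> 0 = 0"
  by (simp add: op_exp_def vec_eq_iff state_zero)

lemma op_exp_sum: "op_exp \<phi> (\<Sum>i\<in>I. f i) = (\<Sum>i\<in>I. op_exp \<phi> (f i))"
  by (induction I rule: infinite_finite_induct) (simp_all add: op_exp_add)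

lemma op_exp_mscale: "op_exp \<phi> (mscale c X) = cscale c (op_exp \<phi> X)"
  by (simp add: op_exp_def mscale_def cscale_def vec_eq_iff state_scaleC)

lemma op_exp_membed [simp]: "op_exp \<phi> (membed B) = B"
  by (simp add: op_exp_def membed_def vec_eq_iff state_scaleC state_one)

lemma op_exp_one [simp]: "op_exp \<phi> (mat 1) = mat 1"
  by (metis membed_one op_exp_membed)

lemma op_exp_bimodule:
  "op_exp \<phi> (membed B ** X) = B ** op_exp \<phi> X"
  "op_exp \<phi> (X ** membed B) = op_exp \<phi> X ** B"
  by (simp_all add: op_exp_def membed_def vec_eq_iff matrix_matrix_mult_def state_sum
      state_scaleC mult_scaleC_left mult_scaleC_right mult.commute)

end

section \<open>Joint moments of free families\<close>

type_synonym ('j, 'd, 'v) ncword = "('j \<times> (complex ^'d^'d, 'v) ncpoly) list"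

definition word_eval ::
    "('j \<Rightarrow> 'v \<Rightarrow> 'a::star_algebra ^'d^'d) \<Rightarrow> ('j, 'd, 'v) ncword \<Rightarrow> 'a^'d^'d" where
  "word_eval X w = foldr (**) (map (\<lambda>(j, p). nceval (X j) p) w) (mat 1)"

lemma word_eval_simps [simp]:
  "word_eval X [] = mat 1"
  "word_eval X ((j, p) # w) = nceval (X j) p ** word_eval X w"
  by (simp_all add: word_eval_def)

lemma word_eval_append: "word_eval X (u @ v) = word_eval X u ** word_eval X v"
  by (induction u) (auto simp: matrix_mul_assoc)

text \<open>Used with \<open>B = E(p)\<close>, this is the centring of \<open>p\<close> inside the polynomials, so that it can again be a
letter of a word.\<close>

definition subtract_coeff :: "complex ^'d^'d \<Rightarrow> (complex ^'d^'d, 'v) ncpoly \<Rightarrow> (complex ^'d^'d, 'v) ncpoly"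
  where "subtract_coeff B p = NAdd p (NCoeff (- B))"

lemma ncvars_subtract_coeff [simp]: "ncvars (subtract_coeff B p) = ncvars p"
  by (simp add: subtract_coeff_def)

lemma nceval_eq_subtract_coeff: "nceval X p = nceval X (subtract_coeff B p) + membed B"
  using membed_uminus[of B] by (simp add: subtract_coeff_def add.assoc add.commute)

lemma (in star_prob_space) op_exp_subtract_coeff:
  "op_exp \<phi> (nceval X (subtract_coeff B p)) = op_exp \<phi> (nceval X p) - B"
  by (simp add: subtract_coeff_def op_exp_add)

text \<open>The words for which freeness asserts that \<open>E\<close> vanishes, with the empty word included.\<close>

definition centred_word ::
    "('a::star_algebra \<Rightarrow> complex) \<Rightarrow> 'v set \<Rightarrow> ('j \<Rightarrow> 'v \<Rightarrow> 'a^'d^'d) \<Rightarrow> 'j set \<Rightarrow>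
     ('j, 'd, 'v) ncword \<Rightarrow> bool" where
  "centred_word \<phi> I X K w \<longleftrightarrow>
     (\<forall>(j, p) \<in> set w. j \<in> K \<and> ncvars p \<subseteq> I \<and> op_exp \<phi> (nceval (X j) p) = 0) \<and>
     successively (\<noteq>) (map fst w)"

lemma centred_word_Nil [simp]: "centred_word \<phi> I X K []"
  by (simp add: centred_word_def)

lemma centred_word_Cons:
  "centred_word \<phi> I X K ((j, p) # w) \<longleftrightarrow>
     j \<in> K \<and> ncvars p \<subseteq> I \<and> op_exp \<phi> (nceval (X j) p) = 0 \<and>
     (w = [] \<or> j \<noteq> fst (hd w)) \<and> centred_word \<phi> I X K w"
  by (cases w) (auto simp: centred_word_def)

lemma centred_word_hd: "centred_word \<phi> I X K w \<Longrightarrow> w \<noteq> [] \<Longrightarrow> fst (hd w) \<in> K"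
  by (cases w) (auto simp: centred_word_def)

lemma centred_word_last: "centred_word \<phi> I X K w \<Longrightarrow> w \<noteq> [] \<Longrightarrow> fst (last w) \<in> K"
  by (cases w rule: rev_cases) (auto simp: centred_word_def)

lemma centred_word_append:
  "centred_word \<phi> I X K (u @ v) \<longleftrightarrow>
     centred_word \<phi> I X K u \<and> centred_word \<phi> I X K v \<and>
     (u = [] \<or> v = [] \<or> fst (last u) \<noteq> fst (hd v))"
  by (auto simp: centred_word_def successively_append_iff last_map hd_map)

lemma centred_word_mono: "centred_word \<phi> I X K w \<Longrightarrow> K \<subseteq> L \<Longrightarrow> centred_word \<phi> I X L w"
  by (auto simp: centred_word_def)

lemma free_families_centred_word:
  assumes "free_families \<phi> J I X" "centred_word \<phi> I X J w" "w \<noteq> []"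
  shows "op_exp \<phi> (word_eval X w) = 0"
  using assms unfolding free_families_def centred_word_def word_eval_def by blast

text \<open>Pairs of corresponding elements in two realisations \<open>X\<close> and \<open>Y\<close>: both are the same sum of centred
alternating words with a coefficient in front. The coefficients of empty words are the only part
that \<open>E\<close> sees under freeness. Keeping the two realisations side by side makes it visible that the
reduction of a word depends on the individual distributions only.\<close>

inductive reduced_sum ::
    "('a::star_algebra \<Rightarrow> complex) \<Rightarrow> 'v set \<Rightarrow> ('j \<Rightarrow> 'v \<Rightarrow> 'a^'d^'d) \<Rightarrow>
     ('j \<Rightarrow> 'v \<Rightarrow> 'b::star_algebra ^'d^'d) \<Rightarrow> 'j set \<Rightarrow> 'a^'d^'d \<Rightarrow> 'b^'d^'d \<Rightarrow> bool"
  for \<phi> I X Y K where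
  word: "centred_word \<phi> I X K u \<Longrightarrow>
    reduced_sum \<phi> I X Y K (membed B ** word_eval X u) (membed B ** word_eval Y u)"
| add: "reduced_sum \<phi> I X Y K x y \<Longrightarrow> reduced_sum \<phi> I X Y K x' y' \<Longrightarrow>
    reduced_sum \<phi> I X Y K (x + x') (y + y')"

definition valid_word :: "'v set \<Rightarrow> 'j set \<Rightarrow> ('j, 'd, 'v) ncword \<Rightarrow> bool" where
  "valid_word I K w \<longleftrightarrow> (\<forall>(j, p) \<in> set w. j \<in> K \<and> ncvars p \<subseteq> I)"

text \<open>A letter in front of a centred alternating word either has a new index, or is merged with the
first letter of the word. In both cases the resulting first letter \<open>r\<close> is split into its centring and
the coefficient \<open>E(r)\<close>, and what remains is again centred and alternating.\<close>

lemma reduced_sum_letter_mult: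
  assumes "star_prob_space \<phi>" "star_prob_space \<psi>"
    and distr: "\<And>j. j \<in> K \<Longrightarrow> same_op_distr \<phi> \<psi> I (X j) (Y j)"
    and j: "j \<in> K" and p: "ncvars p \<subseteq> I"
    and red: "reduced_sum \<phi> I X Y K x y"
  shows "reduced_sum \<phi> I X Y K (nceval (X j) p ** x) (nceval (Y j) p ** y)"
  using red
proof induction
  case (word u B)
  interpret \<phi>: star_prob_space \<phi> by fact
  define q where "q = NMul p (NCoeff B)"
  have q: "ncvars q \<subseteq> I"
    using p by (simp add: q_def)
  have split: "reduced_sum \<phi> I X Y K (nceval (X j) r ** word_eval X v) (nceval (Y j) r ** word_eval Y v)"
    if r: "ncvars r \<subseteq> I" and v: "centred_word \<phi> I X K v" "v = [] \<or> j \<noteq> fst (hd v)" for r v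
  proof -
    define D where "D = op_exp \<phi> (nceval (X j) r)"
    define r' where "r' = subtract_coeff D r"
    have "centred_word \<phi> I X K ((j, r') # v)"
      using r v j by (simp add: centred_word_Cons r'_def \<phi>.op_exp_subtract_coeff D_def)
    from reduced_sum.word[OF this, of Y "mat 1"] reduced_sum.word[OF v(1), of Y D]
    have "reduced_sum \<phi> I X Y K
        (membed (mat 1) ** word_eval X ((j, r') # v) + membed D ** word_eval X v)
        (membed (mat 1) ** word_eval Y ((j, r') # v) + membed D ** word_eval Y v)"
      by (rule reduced_sum.add)
    then show ?thesis
      by (simp add: nceval_eq_subtract_coeff[of _ r D] r'_def membed_one matrix_add_rdistrib)
  qed
  have X: "nceval (X j) p ** (membed B ** word_eval X u) = nceval (X j) q ** word_eval X u"
    and Y: "nceval (Y j) p ** (membed B ** word_eval Y u) = nceval (Y j) q ** word_eval Y u"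
    by (simp_all add: q_def matrix_mul_assoc)
  show ?case
  proof (cases "u = [] \<or> j \<noteq> fst (hd u)")
    case True
    then show ?thesis
      unfolding X Y by (rule split[OF q word.hyps])
  next
    case False
    then obtain s u' where u: "u = (j, s) # u'"
      by (cases u) auto
    with word.hyps have "ncvars (NMul q s) \<subseteq> I" "centred_word \<phi> I X K u'"
        "u' = [] \<or> j \<noteq> fst (hd u')"
      using q by (simp_all add: centred_word_Cons)
    from split[OF this] show ?thesis
      unfolding X Y by (simp add: u matrix_mul_assoc)
  qed
next
  case (add x y x' y')
  then show ?case
    by (simp add: matrix_add_ldistrib reduced_sum.add)
qed

lemma reduced_sum_word_eval:
  assumes "star_prob_space \<phi>" "star_prob_space \<psi>"
    and "\<And>j. j \<in> K \<Longrightarrow> same_op_distr \<phi> \<psi> I (X j) (Y j)"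
    and "valid_word I K w"
  shows "reduced_sum \<phi> I X Y K (word_eval X w) (word_eval Y w)"
  using assms(4)
proof (induction w)
  case Nil
  show ?case
    using reduced_sum.word[of \<phi> I X K "[]" Y "mat 1"] by (simp add: membed_one)
next
  case (Cons l w)
  obtain j p where "l = (j, p)" by fastforce
  with Cons have "j \<in> K" "ncvars p \<subseteq> I" "reduced_sum \<phi> I X Y K (word_eval X w) (word_eval Y w)"
    by (simp_all add: valid_word_def)
  from reduced_sum_letter_mult[OF assms(1-3) this] show ?case
    by (simp add: \<open>l = (j, p)\<close>)
qed

lemma same_op_distr_refl: "same_op_distr \<phi> \<phi> I X X"
  by (simp add: same_op_distr_def)

text \<open>Freeness determines the joint moments: both sides equal the coefficient of the empty word in the
common reduction.\<close>

theorem free_joint_moments_unique: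
  assumes \<phi>: "star_prob_space \<phi>" and \<psi>: "star_prob_space \<psi>"
    and X: "free_families \<phi> J I X" and Y: "free_families \<psi> J I Y"
    and distr: "\<And>j. j \<in> J \<Longrightarrow> same_op_distr \<phi> \<psi> I (X j) (Y j)"
    and w: "valid_word I J w"
  shows "op_exp \<phi> (word_eval X w) = op_exp \<psi> (word_eval Y w)"
proof -
  interpret \<phi>: star_prob_space \<phi> by fact
  interpret \<psi>: star_prob_space \<psi> by fact
  have "reduced_sum \<phi> I X Y J (word_eval X w) (word_eval Y w)"
    by (rule reduced_sum_word_eval[OF \<phi> \<psi> distr w])
  then show ?thesis
  proof induction
    case (word u B)
    then have "centred_word \<psi> I Y J u"
      using distr by (fastforce simp: centred_word_def same_op_distr_def)
    then show ?case
      using free_families_centred_word[OF X word] free_families_centred_word[OF Y]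
      by (cases "u = []") (simp_all add: \<phi>.op_exp_bimodule \<psi>.op_exp_bimodule)
  next
    case (add x y x' y')
    then show ?case by (simp add: \<phi>.op_exp_add \<psi>.op_exp_add)
  qed
qed

text \<open>If the words on both sides are replaced by centred alternating words avoiding \<open>j\<close>, the coefficient
to the right of the middle letter is absorbed in it, and the whole product is a centred alternating
word.\<close>

lemma free_centred_between:
  assumes \<phi>: "star_prob_space \<phi>" and free: "free_families \<phi> J I X"
    and j: "j \<in> J" and p: "ncvars p \<subseteq> I" and cen: "op_exp \<phi> (nceval (X j) p) = 0"
    and u: "valid_word I (J - {j}) u" and v: "valid_word I (J - {j}) v"
  shows "op_exp \<phi> (word_eval X u ** nceval (X j) p ** word_eval X v) = 0"
proof -
  interpret star_prob_space \<phi> by fact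
  note red = reduced_sum_word_eval[OF \<phi> \<phi> same_op_distr_refl]
  have "op_exp \<phi> (x ** nceval (X j) p ** z) = 0"
    if "reduced_sum \<phi> I X X (J - {j}) x x'" "reduced_sum \<phi> I X X (J - {j}) z z'" for x x' z z'
    using that
  proof (induction arbitrary: z z')
    case (word s B)
    note s = \<open>centred_word \<phi> I X (J - {j}) s\<close>
    from word(2) show ?case
    proof induction
      case (word t C)
      have "centred_word \<phi> I X J (s @ (j, NMul p (NCoeff C)) # t)"
        using centred_word_mono[OF s, of J] centred_word_mono[OF word, of J]
          centred_word_last[OF s] centred_word_hd[OF word] j p cen
        by (auto simp: centred_word_append centred_word_Cons op_exp_bimodule)
      from free_families_centred_word[OF free this] show ?case
        by (simp add: word_eval_append matrix_mul_assoc op_exp_bimodule flip: matrix_mul_assoc)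
    next
      case (add x y x' y')
      then show ?case by (simp add: matrix_add_ldistrib op_exp_add)
    qed
  next
    case (add x y x' y')
    from add.IH[OF add.prems] show ?case by (simp add: matrix_add_rdistrib op_exp_add)
  qed
  then show ?thesis
    using red[OF u] red[OF v] by blast
qed

text \<open>Only the coefficient \<open>E(u)\<close> of \<open>u\<close> can contribute: a nonempty centred word between the two letters of
index \<open>j\<close> makes the whole product centred and alternating. Once \<open>u\<close> is a coefficient, the two letters
merge into one, whose centring is killed by \<open>free_centred_between\<close>.\<close>

lemma free_nested_pair:
  assumes \<phi>: "star_prob_space \<phi>" and free: "free_families \<phi> J I X"
    and j: "j \<in> J" and p: "ncvars p \<subseteq> I" and cen_p: "op_exp \<phi> (nceval (X j) p) = 0"
    and q: "ncvars q \<subseteq> I" and cen_q: "op_exp \<phi> (nceval (X j) q) = 0"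
    and u: "valid_word I (J - {j}) u" and v: "valid_word I (J - {j}) v"
  shows "op_exp \<phi> (nceval (X j) p ** word_eval X u ** nceval (X j) q ** word_eval X v) =
         op_exp \<phi> (nceval (X j) p ** membed (op_exp \<phi> (word_eval X u)) ** nceval (X j) q) **
         op_exp \<phi> (word_eval X v)"
proof -
  interpret star_prob_space \<phi> by fact
  note red = reduced_sum_word_eval[OF \<phi> \<phi> same_op_distr_refl]
  have "op_exp \<phi> (nceval (X j) p ** x ** nceval (X j) q ** word_eval X v) =
      op_exp \<phi> (nceval (X j) p ** membed (op_exp \<phi> x) ** nceval (X j) q) ** op_exp \<phi> (word_eval X v)"
    if "reduced_sum \<phi> I X X (J - {j}) x x'" for x x'
    using that
  proof induction
    case (word s B)
    note s = \<open>centred_word \<phi> I X (J - {j}) s\<close>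
    show ?case
    proof (cases "s = []")
      case True
      define r where "r = NMul (NMul p (NCoeff B)) q"
      define D where "D = op_exp \<phi> (nceval (X j) r)"
      have "op_exp \<phi> (word_eval X [] ** nceval (X j) (subtract_coeff D r) ** word_eval X v) = 0"
        using p q by (intro free_centred_between[OF \<phi> free j _ _ _ v])
          (simp_all add: r_def D_def op_exp_subtract_coeff valid_word_def)
      then have "op_exp \<phi> (nceval (X j) r ** word_eval X v) = D ** op_exp \<phi> (word_eval X v)"
        by (simp add: nceval_eq_subtract_coeff[of _ r D] matrix_add_rdistrib op_exp_add
            op_exp_bimodule)
      then show ?thesis
        by (simp add: True r_def D_def op_exp_bimodule)
    next
      case False
      have 0: "op_exp \<phi> (membed B ** word_eval X s) = 0"
        using free_families_centred_word[OF free centred_word_mono[OF s] False]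
        by (auto simp: op_exp_bimodule)
      have "op_exp \<phi> (nceval (X j) p ** (membed B ** word_eval X s) ** nceval (X j) q ** z) = 0"
        if "reduced_sum \<phi> I X X (J - {j}) z z'" for z z'
        using that
      proof induction
        case (word t C)
        have "centred_word \<phi> I X J ((j, NMul p (NCoeff B)) # s @ (j, NMul q (NCoeff C)) # t)"
          using centred_word_mono[OF s, of J] centred_word_mono[OF word, of J] False
            centred_word_last[OF s] centred_word_hd[OF s] centred_word_hd[OF word]
            j p q cen_p cen_q
          by (auto simp: centred_word_append centred_word_Cons op_exp_bimodule)
        from free_families_centred_word[OF free this] show ?case
          by (simp add: word_eval_append matrix_mul_assoc)
      next
        case (add x y x' y')
        then show ?case by (simp add: matrix_add_ldistrib op_exp_add)
      qed
      from this[OF red[OF v]] show ?thesis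
        by (simp add: 0 membed_simps)
    qed
  next
    case (add x y x' y')
    then show ?case
      by (simp add: matrix_add_ldistrib matrix_add_rdistrib op_exp_add membed_simps)
  qed
  from this[OF red[OF u]] show ?thesis .
qed

lemma free_families_relabel:
  assumes free: "free_families \<phi> J I X" and \<sigma>: "inj_on \<sigma> K" "\<sigma> ` K \<subseteq> J"
  shows "free_families \<phi> K I (\<lambda>j. X (\<sigma> j))"
  unfolding free_families_def
proof (intro allI impI)
  fix w
  assume "w \<noteq> []"
    and w: "\<forall>(j, p)\<in>set w. j \<in> K \<and> ncvars p \<subseteq> I \<and> op_exp \<phi> (nceval (X (\<sigma> j)) p) = 0"
    and alt: "successively (\<noteq>) (map fst w)"
  define w' where "w' = map (\<lambda>(j, p). (\<sigma> j, p)) w"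
  have fst_w': "map fst w' = map \<sigma> (map fst w)"
    by (simp add: w'_def case_prod_beta)
  have inK: "fst x \<in> K" if "x \<in> set w" for x
    using w that by (cases x) auto
  have "successively (\<noteq>) (map \<sigma> (map fst w))"
    unfolding successively_map
    using alt[unfolded successively_map] by (rule successively_mono) (use inK \<sigma>(1) in \<open>simp add: inj_on_eq_iff\<close>)
  then have "successively (\<noteq>) (map fst w')"
    by (simp only: fst_w')
  then have "centred_word \<phi> I X J w'"
    using w \<sigma>(2) by (fastforce simp: centred_word_def w'_def)
  then have "op_exp \<phi> (word_eval X w') = 0"
    using \<open>w \<noteq> []\<close> by (intro free_families_centred_word[OF free]) (simp_all add: w'_def)
  moreover have "map (\<lambda>(j, p). nceval (X j) p) w' = map (\<lambda>(j, p). nceval (X (\<sigma> j)) p) w"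
    by (auto simp: w'_def)
  ultimately show "op_exp \<phi> (foldr (**) (map (\<lambda>(j, p). nceval (X (\<sigma> j)) p) w) (mat 1)) = 0"
    by (simp add: word_eval_def)
qed

section \<open>Non-crossing pairings of an interval\<close>

text \<open>General ground sets are needed because the recursion of \<open>kappa\<close> restricts a pairing to subintervals
without relabelling.\<close>

definition nc_pairings :: "nat set \<Rightarrow> nat set set set" where
  "nc_pairings S = {\<pi>. partition_on S \<pi> \<and> (\<forall>b\<in>\<pi>. card b = 2) \<and>
     \<not> (\<exists>a b c d. a < b \<and> b < c \<and> c < d \<and> {a, c} \<in> \<pi> \<and> {b, d} \<in> \<pi>)}"

lemma nc_pairings_finite: "finite S \<Longrightarrow> finite (nc_pairings S)"
  unfolding nc_pairings_def
  by (rule finite_subset[of _ "Pow (Pow S)"]) (auto simp: partition_on_def)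

lemma nc_pairings_blocks_finite: "\<pi> \<in> nc_pairings S \<Longrightarrow> finite S \<Longrightarrow> finite \<pi>"
  by (auto simp: nc_pairings_def finite_elements)

lemma nc_pairings_block_eq:
  assumes "\<pi> \<in> nc_pairings S" "B \<in> \<pi>" "C \<in> \<pi>" "x \<in> B" "x \<in> C"
  shows "B = C"
  using assms by (auto simp: nc_pairings_def partition_on_def disjoint_def)

lemma nc_pairings_obtain_pair:
  assumes "\<pi> \<in> nc_pairings S" "B \<in> \<pi>"
  obtains x y where "B = {x, y}" "x < y"
proof -
  have "card B = 2"
    using assms by (auto simp: nc_pairings_def)
  then obtain x y where "B = {x, y}" "x \<noteq> y"
    by (auto simp: card_2_iff)
  then show ?thesis
    using that[of x y] that[of y x] by (cases "x < y") auto
qed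

lemma nc_pairings_restrict:
  assumes \<pi>: "\<pi> \<in> nc_pairings S" and T: "T \<subseteq> S"
    and closed: "\<And>B. B \<in> \<pi> \<Longrightarrow> B \<inter> T \<noteq> {} \<Longrightarrow> B \<subseteq> T"
  shows "{B \<in> \<pi>. B \<subseteq> T} \<in> nc_pairings T"
proof -
  have "x \<in> \<Union>{B \<in> \<pi>. B \<subseteq> T}" if "x \<in> T" for x
  proof -
    have "x \<in> \<Union>\<pi>"
      using \<pi> T that by (auto simp: nc_pairings_def partition_on_def)
    then show ?thesis
      using closed that by blast
  qed
  then show ?thesis
    using \<pi> by (auto simp: nc_pairings_def partition_on_def disjoint_def)
qed

text \<open>Gluing a pairing inside the arc from \<open>l\<close> to \<open>k\<close> and a pairing after it. All blocks other than the arc lie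
entirely on one side of \<open>k\<close>, so no crossing can arise.\<close>

lemma nc_pairings_insert:
  assumes \<sigma>: "\<sigma> \<in> nc_pairings {Suc l..<k}" and \<tau>: "\<tau> \<in> nc_pairings {Suc k..<r}"
    and "l < k" "k < r"
  shows "insert {l, k} (\<sigma> \<union> \<tau>) \<in> nc_pairings {l..<r}"
proof -
  have U: "\<Union>\<sigma> = {Suc l..<k}" "\<Union>\<tau> = {Suc k..<r}"
    using \<sigma> \<tau> by (auto simp: nc_pairings_def partition_on_def)
  have lk: "\<not> {l, k} \<subseteq> {Suc l..<k}" by auto
  have inner: "B \<subseteq> {Suc l..<k}" if "B \<in> \<sigma>" for B
    using U that by blast
  have outer: "B \<subseteq> {Suc k..<r}" if "B \<in> \<tau>" for B
    using U that by blast
  have "\<Union>(insert {l, k} (\<sigma> \<union> \<tau>)) = {l..<r}"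
    using assms(3,4) by (auto simp: U)
  moreover have "disjoint (insert {l, k} (\<sigma> \<union> \<tau>))"
  proof (rule disjointI)
    fix B C assume BC: "B \<in> insert {l, k} (\<sigma> \<union> \<tau>)" "C \<in> insert {l, k} (\<sigma> \<union> \<tau>)" "B \<noteq> C"
    have d: "disjoint \<sigma>" "disjoint \<tau>"
      using \<sigma> \<tau> by (auto simp: nc_pairings_def partition_on_def)
    have parts: "{l, k} \<inter> {Suc l..<k} = {}" "{l, k} \<inter> {Suc k..<r} = {}"
        "{Suc l..<k} \<inter> {Suc k..<r} = {}"
      using assms(3) by auto
    have B: "B = {l, k} \<or> B \<in> \<sigma> \<and> B \<subseteq> {Suc l..<k} \<or> B \<in> \<tau> \<and> B \<subseteq> {Suc k..<r}"
      using BC(1) inner outer by blast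
    have C: "C = {l, k} \<or> C \<in> \<sigma> \<and> C \<subseteq> {Suc l..<k} \<or> C \<in> \<tau> \<and> C \<subseteq> {Suc k..<r}"
      using BC(2) inner outer by blast
    have "B \<inter> C = {}" if "B \<in> \<sigma> \<and> C \<in> \<sigma> \<or> B \<in> \<tau> \<and> C \<in> \<tau>"
      using that d BC(3) unfolding disjoint_def by blast
    moreover have "B \<inter> C = {}"
      if "B \<subseteq> S" "C \<subseteq> T" "S \<inter> T = {}" for S T
      using that by blast
    ultimately show "B \<inter> C = {}"
      using B C BC(3) parts by (metis Int_commute order_refl)
  qed
  moreover have "{} \<notin> insert {l, k} (\<sigma> \<union> \<tau>)" "\<forall>B\<in>insert {l, k} (\<sigma> \<union> \<tau>). card B = 2"
    using \<sigma> \<tau> assms(3) by (auto simp: nc_pairings_def partition_on_def)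
  moreover have "\<not> (\<exists>a b c d. a < b \<and> b < c \<and> c < d \<and>
      {a, c} \<in> insert {l, k} (\<sigma> \<union> \<tau>) \<and> {b, d} \<in> insert {l, k} (\<sigma> \<union> \<tau>))"
  proof
    assume "\<exists>a b c d. a < b \<and> b < c \<and> c < d \<and>
      {a, c} \<in> insert {l, k} (\<sigma> \<union> \<tau>) \<and> {b, d} \<in> insert {l, k} (\<sigma> \<union> \<tau>)"
    then obtain a b c d where abcd: "a < b" "b < c" "c < d"
      and ac: "{a, c} = {l, k} \<or> {a, c} \<in> \<sigma> \<or> {a, c} \<in> \<tau>"
      and bd: "{b, d} = {l, k} \<or> {b, d} \<in> \<sigma> \<or> {b, d} \<in> \<tau>"
      by blast
    have "(a = l \<and> c = k) \<or> (l < a \<and> c < k \<and> {a, c} \<in> \<sigma>) \<or> (k < a \<and> {a, c} \<in> \<tau>)"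
      using ac inner[of "{a, c}"] outer[of "{a, c}"] abcd assms(3) by (auto simp: doubleton_eq_iff)
    moreover have "(b = l \<and> d = k) \<or> (l < b \<and> d < k \<and> {b, d} \<in> \<sigma>) \<or> (k < b \<and> {b, d} \<in> \<tau>)"
      using bd inner[of "{b, d}"] outer[of "{b, d}"] abcd assms(3) by (auto simp: doubleton_eq_iff)
    moreover have "\<not> ({a, c} \<in> \<sigma> \<and> {b, d} \<in> \<sigma>)" "\<not> ({a, c} \<in> \<tau> \<and> {b, d} \<in> \<tau>)"
      using \<sigma> \<tau> abcd by (auto simp: nc_pairings_def)
    ultimately show False
      using abcd by auto
  qed
  ultimately show ?thesis
    by (simp only: nc_pairings_def partition_on_def mem_Collect_eq simp_thms)
qed

lemma nc_pairings_insert_restrict: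
  assumes \<sigma>: "\<sigma> \<in> nc_pairings {Suc l..<k}" and \<tau>: "\<tau> \<in> nc_pairings {Suc k..<r}" and "l < k"
  shows "{B \<in> insert {l, k} (\<sigma> \<union> \<tau>). B \<subseteq> {l<..<k}} = \<sigma>"
    and "{B \<in> insert {l, k} (\<sigma> \<union> \<tau>). B \<subseteq> {k<..}} = \<tau>"
proof -
  have inner: "B \<subseteq> {Suc l..<k}" "B \<noteq> {}" if "B \<in> \<sigma>" for B
    using \<sigma> that by (auto simp: nc_pairings_def partition_on_def)
  have outer: "B \<subseteq> {Suc k..<r}" "B \<noteq> {}" if "B \<in> \<tau>" for B
    using \<tau> that by (auto simp: nc_pairings_def partition_on_def)
  show "{B \<in> insert {l, k} (\<sigma> \<union> \<tau>). B \<subseteq> {l<..<k}} = \<sigma>"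
    and "{B \<in> insert {l, k} (\<sigma> \<union> \<tau>). B \<subseteq> {k<..}} = \<tau>"
    using inner outer \<open>l < k\<close> by fastforce+
qed

lemma nc_pairings_partner:
  assumes \<pi>: "\<pi> \<in> nc_pairings {l..<r}" and k: "{l, k} \<in> \<pi>"
  shows "(THE k. {l, k} \<in> \<pi>) = k"
proof (rule the_equality)
  fix k' assume k': "{l, k'} \<in> \<pi>"
  have "card {l, k} = 2"
    using \<pi> k by (auto simp: nc_pairings_def)
  then show "k' = k"
    using nc_pairings_block_eq[OF \<pi> k' k, of l] by (auto simp: doubleton_eq_iff)
qed fact

text \<open>Converse of the gluing: since no block crosses the arc from \<open>l\<close> to its partner \<open>k\<close>, every other block
lies inside or after it.\<close>

lemma nc_pairings_split:
  assumes \<pi>: "\<pi> \<in> nc_pairings {l..<r}" and k: "{l, k} \<in> \<pi>"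
  shows "l < k" "k < r"
    and "{B \<in> \<pi>. B \<subseteq> {l<..<k}} \<in> nc_pairings {Suc l..<k}"
    and "{B \<in> \<pi>. B \<subseteq> {k<..}} \<in> nc_pairings {Suc k..<r}"
    and "insert {l, k} ({B \<in> \<pi>. B \<subseteq> {l<..<k}} \<union> {B \<in> \<pi>. B \<subseteq> {k<..}}) = \<pi>"
proof -
  have U: "\<Union>\<pi> = {l..<r}"
    using \<pi> by (auto simp: nc_pairings_def partition_on_def)
  have "card {l, k} = 2"
    using \<pi> k by (auto simp: nc_pairings_def)
  then have "l \<noteq> k" by auto
  moreover have "{l, k} \<subseteq> {l..<r}"
    using k U by blast
  ultimately show lk: "l < k" and kr: "k < r"
    by auto
  have cases: "B = {l, k} \<or> B \<subseteq> {l<..<k} \<or> B \<subseteq> {k<..<r}" if B: "B \<in> \<pi>" for B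
  proof (cases "l \<in> B \<or> k \<in> B")
    case True
    then show ?thesis
      using nc_pairings_block_eq[OF \<pi> B k] by auto
  next
    case False
    obtain x y where xy: "B = {x, y}" "x < y"
      using nc_pairings_obtain_pair[OF \<pi> B] .
    have "{x, y} \<subseteq> {l..<r}"
      using B U xy by blast
    moreover have "\<not> (l < x \<and> x < k \<and> k < y)"
      using \<pi> k B xy by (auto simp: nc_pairings_def)
    ultimately show ?thesis
      using False xy by auto
  qed
  have *: "{B \<in> \<pi>. B \<subseteq> {k<..}} = {B \<in> \<pi>. B \<subseteq> {k<..<r}}"
  proof -
    have "B \<subseteq> {l..<r}" if "B \<in> \<pi>" for B
      using U that by blast
    then show ?thesis by fastforce
  qed
  have "{B \<in> \<pi>. B \<subseteq> {l<..<k}} \<in> nc_pairings {l<..<k}"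
    by (rule nc_pairings_restrict[OF \<pi>]) (use cases kr in \<open>fastforce+\<close>)
  then show "{B \<in> \<pi>. B \<subseteq> {l<..<k}} \<in> nc_pairings {Suc l..<k}"
    by (simp add: atLeastSucLessThan_greaterThanLessThan)
  have "{B \<in> \<pi>. B \<subseteq> {k<..<r}} \<in> nc_pairings {k<..<r}"
    by (rule nc_pairings_restrict[OF \<pi>]) (use cases lk in \<open>fastforce+\<close>)
  then show "{B \<in> \<pi>. B \<subseteq> {k<..}} \<in> nc_pairings {Suc k..<r}"
    by (simp add: * atLeastSucLessThan_greaterThanLessThan)
  show "insert {l, k} ({B \<in> \<pi>. B \<subseteq> {l<..<k}} \<union> {B \<in> \<pi>. B \<subseteq> {k<..}}) = \<pi>"
    unfolding * using cases k by blast
qed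

lemma kappa_nc_pairing:
  assumes \<pi>: "\<pi> \<in> nc_pairings {l..<r}" and k: "{l, k} \<in> \<pi>"
  shows "kappa \<eta> \<pi> = \<eta> (kappa \<eta> {B \<in> \<pi>. B \<subseteq> {l<..<k}}) ** kappa \<eta> {B \<in> \<pi>. B \<subseteq> {k<..}}"
proof -
  have U: "\<Union>\<pi> = {l..<r}"
    using \<pi> by (auto simp: nc_pairings_def partition_on_def)
  then have "l < r"
    using k by auto
  then have Min: "Min (\<Union>\<pi>) = l"
    unfolding U by (intro Min_eqI) auto
  show ?thesis
    using nc_pairings_blocks_finite[OF \<pi>] k by (subst kappa.simps) (simp add: Min nc_pairings_partner[OF \<pi> k] Let_def)
qed

text \<open>The operator-valued Catalan numbers: the sum of \<open>kappa \<eta> \<pi>\<close> over the non-crossing pairings of \<open>m\<close>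
points, given by the recursion over the partner of the first point.\<close>

fun nc_sum :: "(complex ^'d^'d \<Rightarrow> complex ^'d^'d) \<Rightarrow> nat \<Rightarrow> complex ^'d^'d" where
  "nc_sum \<eta> 0 = mat 1"
| "nc_sum \<eta> (Suc 0) = 0"
| "nc_sum \<eta> (Suc (Suc m)) = (\<Sum>k\<le>m. \<eta> (nc_sum \<eta> k) ** nc_sum \<eta> (m - k))"

lemma nc_pairings_rec_bij:
  "bij_betw (\<lambda>(k, \<sigma>, \<tau>). insert {l, k} (\<sigma> \<union> \<tau>))
     (SIGMA k:{l<..<r}. nc_pairings {Suc l..<k} \<times> nc_pairings {Suc k..<r}) (nc_pairings {l..<r})"
  if "l < r"
proof (rule bij_betwI[where g =
      "\<lambda>\<pi>. let k = (THE k. {l, k} \<in> \<pi>) in (k, {B \<in> \<pi>. B \<subseteq> {l<..<k}}, {B \<in> \<pi>. B \<subseteq> {k<..}})"])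
  have ex: "\<exists>k. {l, k} \<in> \<pi>" if \<pi>: "\<pi> \<in> nc_pairings {l..<r}" for \<pi>
  proof -
    have "l \<in> \<Union>\<pi>"
      using \<pi> \<open>l < r\<close> by (auto simp: nc_pairings_def partition_on_def)
    then obtain B where B: "B \<in> \<pi>" "l \<in> B" by blast
    from nc_pairings_obtain_pair[OF \<pi> B(1)] obtain x y where "B = {x, y}" .
    then show ?thesis
      using B by (metis insertE insert_commute singletonD)
  qed
  show "(\<lambda>(k, \<sigma>, \<tau>). insert {l, k} (\<sigma> \<union> \<tau>))
      \<in> (SIGMA k:{l<..<r}. nc_pairings {Suc l..<k} \<times> nc_pairings {Suc k..<r}) \<rightarrow> nc_pairings {l..<r}"
    using nc_pairings_insert by auto
  show "(\<lambda>\<pi>. let k = (THE k. {l, k} \<in> \<pi>) in (k, {B \<in> \<pi>. B \<subseteq> {l<..<k}}, {B \<in> \<pi>. B \<subseteq> {k<..}}))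
      \<in> nc_pairings {l..<r} \<rightarrow> (SIGMA k:{l<..<r}. nc_pairings {Suc l..<k} \<times> nc_pairings {Suc k..<r})"
  proof
    fix \<pi> assume \<pi>: "\<pi> \<in> nc_pairings {l..<r}"
    obtain k where k: "{l, k} \<in> \<pi>" using ex[OF \<pi>] ..
    show "(let k = (THE k. {l, k} \<in> \<pi>) in (k, {B \<in> \<pi>. B \<subseteq> {l<..<k}}, {B \<in> \<pi>. B \<subseteq> {k<..}}))
      \<in> (SIGMA k:{l<..<r}. nc_pairings {Suc l..<k} \<times> nc_pairings {Suc k..<r})"
      using nc_pairings_split[OF \<pi> k] by (simp add: nc_pairings_partner[OF \<pi> k])
  qed
  fix \<pi> assume \<pi>: "\<pi> \<in> nc_pairings {l..<r}"
  obtain k where k: "{l, k} \<in> \<pi>" using ex[OF \<pi>] ..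
  show "(case let k = (THE k. {l, k} \<in> \<pi>) in (k, {B \<in> \<pi>. B \<subseteq> {l<..<k}}, {B \<in> \<pi>. B \<subseteq> {k<..}}) of
      (k, \<sigma>, \<tau>) \<Rightarrow> insert {l, k} (\<sigma> \<union> \<tau>)) = \<pi>"
    using nc_pairings_split(5)[OF \<pi> k] by (simp add: nc_pairings_partner[OF \<pi> k])
next
  fix t assume "t \<in> (SIGMA k:{l<..<r}. nc_pairings {Suc l..<k} \<times> nc_pairings {Suc k..<r})"
  then obtain k \<sigma> \<tau> where t: "t = (k, \<sigma>, \<tau>)" and k: "l < k" "k < r"
    and \<sigma>: "\<sigma> \<in> nc_pairings {Suc l..<k}" and \<tau>: "\<tau> \<in> nc_pairings {Suc k..<r}"
    by auto
  define \<pi> where "\<pi> = insert {l, k} (\<sigma> \<union> \<tau>)"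
  have \<pi>: "\<pi> \<in> nc_pairings {l..<r}"
    unfolding \<pi>_def by (rule nc_pairings_insert[OF \<sigma> \<tau> k])
  have the: "(THE k. {l, k} \<in> \<pi>) = k"
    by (rule nc_pairings_partner[OF \<pi>]) (simp add: \<pi>_def)
  have "{B \<in> \<pi>. B \<subseteq> {l<..<k}} = \<sigma>" "{B \<in> \<pi>. B \<subseteq> {k<..}} = \<tau>"
    unfolding \<pi>_def by (rule nc_pairings_insert_restrict[OF \<sigma> \<tau> k(1)])+
  then show "(let k = (THE k. {l, k} \<in> (case t of (k, \<sigma>, \<tau>) \<Rightarrow> insert {l, k} (\<sigma> \<union> \<tau>))) in
      (k, {B \<in> (case t of (k, \<sigma>, \<tau>) \<Rightarrow> insert {l, k} (\<sigma> \<union> \<tau>)). B \<subseteq> {l<..<k}},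
       {B \<in> (case t of (k, \<sigma>, \<tau>) \<Rightarrow> insert {l, k} (\<sigma> \<union> \<tau>)). B \<subseteq> {k<..}})) = t"
    using the by (simp add: t Let_def flip: \<pi>_def)
qed

lemma sum_kappa_nc_pairings:
  assumes add: "\<And>A B. \<eta> (A + B) = \<eta> A + \<eta> B"
  shows "(\<Sum>\<pi>\<in>nc_pairings {l..<l + m}. kappa \<eta> \<pi>) = nc_sum \<eta> m"
proof (induction m arbitrary: l rule: less_induct)
  case (less m)
  have \<eta>0: "\<eta> 0 = 0"
    using add[of 0 0] by simp
  have \<eta>_sum: "\<eta> (\<Sum>i\<in>I. f i) = (\<Sum>i\<in>I. \<eta> (f i))" for I :: "nat set set set" and f
    by (induction I rule: infinite_finite_induct) (simp_all add: \<eta>0 add)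
  have rec: "(\<Sum>\<pi>\<in>nc_pairings {l..<l + m}. kappa \<eta> \<pi>) =
      (\<Sum>k\<in>{l<..<l + m}. \<eta> (\<Sum>\<sigma>\<in>nc_pairings {Suc l..<k}. kappa \<eta> \<sigma>) **
        (\<Sum>\<tau>\<in>nc_pairings {Suc k..<l + m}. kappa \<eta> \<tau>))" if "m > 0"
  proof -
    let ?S = "SIGMA k:{l<..<l + m}. nc_pairings {Suc l..<k} \<times> nc_pairings {Suc k..<l + m}"
    let ?f = "\<lambda>(k, \<sigma>, \<tau>). insert {l, k} (\<sigma> \<union> \<tau>)"
    have bij: "bij_betw ?f ?S (nc_pairings {l..<l + m})"
      using that by (intro nc_pairings_rec_bij) simp
    have "(\<Sum>\<pi>\<in>nc_pairings {l..<l + m}. kappa \<eta> \<pi>) = (\<Sum>t\<in>?S. kappa \<eta> (?f t))"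
      by (rule sum.reindex_bij_betw[OF bij, symmetric])
    also have "\<dots> = (\<Sum>(k, \<sigma>, \<tau>)\<in>?S. \<eta> (kappa \<eta> \<sigma>) ** kappa \<eta> \<tau>)"
    proof (rule sum.cong[OF refl], clarify)
      fix k \<sigma> \<tau> assume k: "k \<in> {l<..<l + m}" and \<sigma>: "\<sigma> \<in> nc_pairings {Suc l..<k}"
        and \<tau>: "\<tau> \<in> nc_pairings {Suc k..<l + m}"
      have \<pi>: "insert {l, k} (\<sigma> \<union> \<tau>) \<in> nc_pairings {l..<l + m}"
        using k by (intro nc_pairings_insert[OF \<sigma> \<tau>]) auto
      have "l < k" using k by simp
      from nc_pairings_insert_restrict[OF \<sigma> \<tau> this]
      show "kappa \<eta> (insert {l, k} (\<sigma> \<union> \<tau>)) = \<eta> (kappa \<eta> \<sigma>) ** kappa \<eta> \<tau>"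
        using kappa_nc_pairing[OF \<pi>, of k \<eta>] by simp
    qed
    also have "\<dots> = (\<Sum>k\<in>{l<..<l + m}. \<Sum>\<sigma>\<in>nc_pairings {Suc l..<k}.
        \<Sum>\<tau>\<in>nc_pairings {Suc k..<l + m}. \<eta> (kappa \<eta> \<sigma>) ** kappa \<eta> \<tau>)"
      by (simp add: sum.Sigma nc_pairings_finite sum.cartesian_product)
    also have "\<dots> = (\<Sum>k\<in>{l<..<l + m}. \<eta> (\<Sum>\<sigma>\<in>nc_pairings {Suc l..<k}. kappa \<eta> \<sigma>) **
        (\<Sum>\<tau>\<in>nc_pairings {Suc k..<l + m}. kappa \<eta> \<tau>))"
      by (simp add: \<eta>_sum matrix_mult_sum(2)) (simp add: matrix_mult_sum(1))
    finally show ?thesis .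
  qed
  consider "m = 0" | "m = 1" | m' where "m = Suc (Suc m')"
    by (metis One_nat_def not0_implies_Suc)
  then show ?case
  proof cases
    case 1
    have "nc_pairings {} = {{}}"
      by (auto simp: nc_pairings_def partition_on_def)
    then show ?thesis
      using 1 by (simp add: kappa.simps)
  next
    case 2
    then have "{l<..<l + m} = {}" by auto
    then show ?thesis
      using 2 rec by simp
  next
    case 3
    have "(\<Sum>\<pi>\<in>nc_pairings {l..<l + m}. kappa \<eta> \<pi>) =
      (\<Sum>k\<in>{l<..<l + m}. \<eta> (\<Sum>\<sigma>\<in>nc_pairings {Suc l..<k}. kappa \<eta> \<sigma>) **
        (\<Sum>\<tau>\<in>nc_pairings {Suc k..<l + m}. kappa \<eta> \<tau>))"
      using 3 by (intro rec) simp
    also have "\<dots> = (\<Sum>k\<le>m'. \<eta> (\<Sum>\<sigma>\<in>nc_pairings {Suc l..<Suc l + k}. kappa \<eta> \<sigma>) **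
        (\<Sum>\<tau>\<in>nc_pairings {Suc (Suc l + k)..<Suc (Suc l + k) + (m' - k)}. kappa \<eta> \<tau>))"
      by (rule sum.reindex_bij_witness[where i = "\<lambda>k. Suc l + k" and j = "\<lambda>k. k - Suc l"])
        (use 3 in \<open>auto simp: add.commute\<close>)
    also have "\<dots> = (\<Sum>k\<le>m'. \<eta> (nc_sum \<eta> k) ** nc_sum \<eta> (m' - k))"
    proof (rule sum.cong[OF refl])
      fix k assume "k \<in> {..m'}"
      then have "k < m" "m' - k < m"
        using 3 by auto
      then show "\<eta> (\<Sum>\<sigma>\<in>nc_pairings {Suc l..<Suc l + k}. kappa \<eta> \<sigma>) **
        (\<Sum>\<tau>\<in>nc_pairings {Suc (Suc l + k)..<Suc (Suc l + k) + (m' - k)}. kappa \<eta> \<tau>)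
        = \<eta> (nc_sum \<eta> k) ** nc_sum \<eta> (m' - k)"
        by (simp only: less.IH)
    qed
    finally show ?thesis
      by (simp add: 3)
  qed
qed

lemma sum_kappa_NC2:
  assumes "\<And>A B. \<eta> (A + B) = \<eta> A + \<eta> B"
  shows "(\<Sum>\<pi>\<in>NC2 m. kappa \<eta> \<pi>) = nc_sum \<eta> m"
proof -
  have "NC2 m = nc_pairings {1..<1 + m}"
    by (simp add: NC2_def nc_pairings_def atLeastLessThanSuc_atLeastAtMost)
  then show ?thesis
    using sum_kappa_nc_pairings[OF assms, of 1 m] by simp
qed

section \<open>Mixed moments of the independent coefficients\<close>

definition letters_at :: "'j \<Rightarrow> ('j \<times> 'v) list \<Rightarrow> 'v list" where
  "letters_at j w = map snd (filter (\<lambda>l. fst l = j) w)"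

lemma letters_at_simps [simp]:
  "letters_at j [] = []"
  "letters_at j (l # w) = (if fst l = j then snd l # letters_at j w else letters_at j w)"
  "letters_at j (u @ v) = letters_at j u @ letters_at j v"
  by (simp_all add: letters_at_def)

lemma letters_at_eq_Nil: "j \<notin> fst ` set w \<Longrightarrow> letters_at j w = []"
  by (force simp: letters_at_def filter_empty_conv)

lemma set_letters_at: "set (letters_at j w) \<subseteq> snd ` set w"
  by (auto simp: letters_at_def)

lemma letters_at_relabel:
  assumes "inj_on \<sigma> (fst ` set w)" "j \<in> fst ` set w"
  shows "letters_at (\<sigma> j) (map (map_prod \<sigma> id) w) = letters_at j w"
proof -
  have "filter (\<lambda>l. \<sigma> (fst l) = \<sigma> j) w = filter (\<lambda>l. fst l = j) w"
    using assms by (intro filter_cong) (auto simp: inj_on_eq_iff)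
  then show ?thesis
    by (simp add: letters_at_def filter_map o_def)
qed

lemma prod_letters_at:
  fixes f :: "'j \<Rightarrow> 'v \<Rightarrow> 'c::comm_monoid_mult"
  assumes "finite S" "fst ` set w \<subseteq> S"
  shows "(\<Prod>l\<leftarrow>w. f (fst l) (snd l)) = (\<Prod>j\<in>S. \<Prod>i\<leftarrow>letters_at j w. f j i)"
  using assms(2)
proof (induction w)
  case (Cons l w)
  have "(\<Prod>j\<in>S. \<Prod>i\<leftarrow>letters_at j (l # w). f j i) =
      (\<Prod>j\<in>S. (if fst l = j then f j (snd l) else 1) * (\<Prod>i\<leftarrow>letters_at j w. f j i))"
    by (rule prod.cong) auto
  also have "\<dots> = f (fst l) (snd l) * (\<Prod>j\<in>S. \<Prod>i\<leftarrow>letters_at j w. f j i)"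
    using assms(1) Cons.prems by (simp add: prod.distrib prod.delta)
  finally show ?case
    using Cons by simp
qed simp

definition block_moment :: "'w measure \<Rightarrow> ('v \<Rightarrow> 'w \<Rightarrow> complex) \<Rightarrow> 'v list \<Rightarrow> complex" where
  "block_moment M a is = (\<integral>\<omega>. (\<Prod>i\<leftarrow>is. a i \<omega>) \<partial>M)"

text \<open>The mixed moment of independent copies, expressed through the original family \<open>a\<close>. It is a function
of the word alone, so its invariance under renaming of indices is immediate.\<close>

definition indep_moment :: "'w measure \<Rightarrow> ('v \<Rightarrow> 'w \<Rightarrow> complex) \<Rightarrow> ('j \<times> 'v) list \<Rightarrow> complex" where
  "indep_moment M a w = (\<Prod>j\<in>fst ` set w. block_moment M a (letters_at j w))"

lemma indep_moment_Nil [simp]: "indep_moment M a [] = 1"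
  by (simp add: indep_moment_def)

lemma indep_moment_relabel:
  assumes "inj_on \<sigma> (fst ` set w)"
  shows "indep_moment M a (map (map_prod \<sigma> id) w) = indep_moment M a w"
proof -
  have "fst ` set (map (map_prod \<sigma> id) w) = \<sigma> ` fst ` set w"
    by (simp add: image_image)
  then show ?thesis
    unfolding indep_moment_def
    using assms by (simp add: prod.reindex letters_at_relabel del: set_map)
qed

lemma indep_moment_nested_pair:
  assumes "j \<notin> fst ` set u" "j \<notin> fst ` set v" "fst ` set u \<inter> fst ` set v = {}"
  shows "indep_moment M a ((j, i) # u @ (j, i') # v) =
    block_moment M a [i, i'] * indep_moment M a u * indep_moment M a v"
proof -
  let ?w = "(j, i) # u @ (j, i') # v"
  have "indep_moment M a ?w = (\<Prod>k\<in>{j} \<union> (fst ` set u \<union> fst ` set v). block_moment M a (letters_at k ?w))"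
    unfolding indep_moment_def by (rule prod.cong) auto
  also have "\<dots> = block_moment M a (letters_at j ?w) *
      ((\<Prod>k\<in>fst ` set u. block_moment M a (letters_at k ?w)) *
       (\<Prod>k\<in>fst ` set v. block_moment M a (letters_at k ?w)))"
    using assms by (simp add: prod.union_disjoint)
  also have "letters_at j ?w = [i, i']"
    using assms by (simp add: letters_at_eq_Nil)
  also have "(\<Prod>k\<in>fst ` set u. block_moment M a (letters_at k ?w)) = indep_moment M a u"
    unfolding indep_moment_def
  proof (rule prod.cong[OF refl])
    fix k assume "k \<in> fst ` set u"
    then have "k \<noteq> j" "k \<notin> fst ` set v"
      using assms by auto
    then show "block_moment M a (letters_at k ?w) = block_moment M a (letters_at k u)"
      by (simp add: letters_at_eq_Nil)
  qed
  also have "(\<Prod>k\<in>fst ` set v. block_moment M a (letters_at k ?w)) = indep_moment M a v"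
    unfolding indep_moment_def
  proof (rule prod.cong[OF refl])
    fix k assume "k \<in> fst ` set v"
    then have "k \<noteq> j" "k \<notin> fst ` set u"
      using assms by auto
    then show "block_moment M a (letters_at k ?w) = block_moment M a (letters_at k v)"
      by (simp add: letters_at_eq_Nil)
  qed
  finally show ?thesis
    by (simp add: mult.assoc)
qed

text \<open>By \<open>x y \<le> x\<^sup>2 + y\<^sup>2\<close>, the \<open>p\<close>-th absolute moment of a product is controlled by the moments of order \<open>2 p\<close>
of the factors.\<close>

lemma Linf_minus_mult:
  assumes "f \<in> Linf_minus M" "g \<in> Linf_minus M"
  shows "(\<lambda>\<omega>. f \<omega> * g \<omega>) \<in> Linf_minus M"
proof -
  have [measurable]: "f \<in> borel_measurable M" "g \<in> borel_measurable M"
    using assms by (auto simp: Linf_minus_def)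
  have "integrable M (\<lambda>\<omega>. cmod (f \<omega> * g \<omega>) powr p)" if p: "p \<ge> 1" for p :: real
  proof (rule Bochner_Integration.integrable_bound)
    show "integrable M (\<lambda>\<omega>. cmod (f \<omega>) powr (2 * p) + cmod (g \<omega>) powr (2 * p))"
      using assms p by (auto simp: Linf_minus_def)
    show "AE \<omega> in M. norm (cmod (f \<omega> * g \<omega>) powr p)
        \<le> norm (cmod (f \<omega>) powr (2 * p) + cmod (g \<omega>) powr (2 * p))"
    proof (rule AE_I2)
      fix \<omega>
      define x where "x = cmod (f \<omega>) powr p"
      define y where "y = cmod (g \<omega>) powr p"
      have "0 \<le> x * y"
        by (simp add: x_def y_def)
      then have "x * y \<le> x * x + y * y"
        using zero_le_square[of "x - y"] unfolding left_diff_distrib right_diff_distrib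
        by (simp add: mult.commute[of y x])
      moreover have "cmod (f \<omega> * g \<omega>) powr p = x * y"
        by (simp add: x_def y_def norm_mult powr_mult)
      moreover have "cmod (f \<omega>) powr (2 * p) = x * x" "cmod (g \<omega>) powr (2 * p) = y * y"
        by (simp_all add: x_def y_def flip: powr_add)
      moreover have "0 \<le> x * y" "0 \<le> x * x + y * y"
        by (auto simp: x_def y_def)
      ultimately show "norm (cmod (f \<omega> * g \<omega>) powr p)
          \<le> norm (cmod (f \<omega>) powr (2 * p) + cmod (g \<omega>) powr (2 * p))"
        by simp
    qed
  qed simp
  then show ?thesis
    by (simp add: Linf_minus_def)
qed

lemma Linf_minus_integrable:
  assumes "f \<in> Linf_minus M"
  shows "integrable M f"
proof -
  have "integrable M (\<lambda>\<omega>. cmod (f \<omega>) powr 1)" "f \<in> borel_measurable M"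
    using assms by (auto simp: Linf_minus_def)
  then show ?thesis
    by (simp add: integrable_norm_iff)
qed

lemma (in prob_space) Linf_minus_prod_list:
  assumes "\<And>i. i \<in> set is \<Longrightarrow> a i \<in> Linf_minus M"
  shows "(\<lambda>\<omega>. \<Prod>i\<leftarrow>is. a i \<omega>) \<in> Linf_minus M"
  using assms
proof (induction "is")
  case Nil
  show ?case by (simp add: Linf_minus_def)
next
  case (Cons i "is")
  then show ?case by (simp add: Linf_minus_mult)
qed

lemma expectation_indep_copies:
  fixes a :: "nat \<Rightarrow> 'w \<Rightarrow> complex" and a' :: "nat \<Rightarrow> nat \<Rightarrow> 'v \<Rightarrow> complex"
  assumes M': "prob_space M'"
    and a: "\<And>i. i \<in> L \<Longrightarrow> a i \<in> Linf_minus M"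
    and a': "\<And>j i. j \<in> J \<Longrightarrow> i \<in> L \<Longrightarrow> a' j i \<in> Linf_minus M'"
    and indep: "prob_space.indep_vars M' (\<lambda>_. Pi\<^sub>M L (\<lambda>_. borel)) (\<lambda>j \<omega>. \<lambda>i\<in>L. a' j i \<omega>) J"
    and distr: "\<And>j. j \<in> J \<Longrightarrow> distr M' (Pi\<^sub>M L (\<lambda>_. borel)) (\<lambda>\<omega>. \<lambda>i\<in>L. a' j i \<omega>) =
      distr M (Pi\<^sub>M L (\<lambda>_. borel)) (\<lambda>\<omega>. \<lambda>i\<in>L. a i \<omega>)"
    and w: "set w \<subseteq> J \<times> L"
  shows "(\<integral>\<omega>. (\<Prod>l\<leftarrow>w. a' (fst l) (snd l) \<omega>) \<partial>M') = indep_moment M a w"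
proof -
  interpret M': prob_space M' by fact
  let ?P = "Pi\<^sub>M L (\<lambda>_. borel) :: (nat \<Rightarrow> complex) measure"
  let ?g = "\<lambda>j x. \<Prod>i\<leftarrow>letters_at j w. x i :: complex"
  have J: "fst ` set w \<subseteq> J" and L: "set (letters_at j w) \<subseteq> L" for j
    using w set_letters_at[of j w] by force+
  have meas: "(\<lambda>x. \<Prod>i\<leftarrow>is. x i :: complex) \<in> borel_measurable ?P" if "set is \<subseteq> L" for "is"
    using that by (induction "is") auto
  have a_meas: "(\<lambda>\<omega>. \<lambda>i\<in>L. a i \<omega>) \<in> measurable M ?P"
    using a by (intro measurable_restrict) (auto simp: Linf_minus_def)
  have a'_meas: "(\<lambda>\<omega>. \<lambda>i\<in>L. a' j i \<omega>) \<in> measurable M' ?P" if "j \<in> J" for j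
    using a'[OF that] by (intro measurable_restrict) (auto simp: Linf_minus_def)
  have restr: "(\<Prod>i\<leftarrow>letters_at j w. (\<lambda>i\<in>L. f i) i) = (\<Prod>i\<leftarrow>letters_at j w. f i :: complex)" for j f
    by (rule arg_cong[where f = prod_list], rule map_cong) (use L[of j] in auto)
  have "(\<integral>\<omega>. (\<Prod>l\<leftarrow>w. a' (fst l) (snd l) \<omega>) \<partial>M') =
      (\<integral>\<omega>. (\<Prod>j\<in>fst ` set w. ?g j (\<lambda>i\<in>L. a' j i \<omega>)) \<partial>M')"
    unfolding restr by (subst prod_letters_at[of "fst ` set w"]) auto
  also have "\<dots> = (\<Prod>j\<in>fst ` set w. \<integral>\<omega>. ?g j (\<lambda>i\<in>L. a' j i \<omega>) \<partial>M')"
  proof (rule M'.indep_vars_lebesgue_integral)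
    show "M'.indep_vars (\<lambda>_. borel) (\<lambda>j \<omega>. ?g j (\<lambda>i\<in>L. a' j i \<omega>)) (fst ` set w)"
      using M'.indep_vars_subset[OF indep J] meas[OF L]
      by (rule M'.indep_vars_compose2[where Y = ?g])
    show "integrable M' (\<lambda>\<omega>. ?g j (\<lambda>i\<in>L. a' j i \<omega>))" if "j \<in> fst ` set w" for j
      unfolding restr using a' J L that
      by (intro Linf_minus_integrable M'.Linf_minus_prod_list) blast
  qed simp
  also have "\<dots> = (\<Prod>j\<in>fst ` set w. block_moment M a (letters_at j w))"
  proof (rule prod.cong[OF refl])
    fix j assume "j \<in> fst ` set w"
    then have j: "j \<in> J" using J by blast
    have "(\<integral>\<omega>. ?g j (\<lambda>i\<in>L. a' j i \<omega>) \<partial>M') = (\<integral>x. ?g j x \<partial>distr M' ?P (\<lambda>\<omega>. \<lambda>i\<in>L. a' j i \<omega>))"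
      by (rule integral_distr[OF a'_meas[OF j] meas[OF L], symmetric])
    also have "\<dots> = (\<integral>\<omega>. ?g j (\<lambda>i\<in>L. a i \<omega>) \<partial>M)"
      unfolding distr[OF j] by (rule integral_distr[OF a_meas meas[OF L]])
    finally show "(\<integral>\<omega>. ?g j (\<lambda>i\<in>L. a' j i \<omega>) \<partial>M') = block_moment M a (letters_at j w)"
      unfolding restr block_moment_def .
  qed
  finally show ?thesis
    by (simp add: indep_moment_def)
qed

text \<open>A linear relation that holds almost surely is a property of the joint distribution, so it passes to
copies. It transfers the centring of \<open>Z\<close> to its copies.\<close>

lemma AE_linear_relation_copies:
  fixes a :: "'i \<Rightarrow> 'w \<Rightarrow> complex" and b :: "'i \<Rightarrow> 'v \<Rightarrow> complex"
  assumes L: "finite L"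
    and a: "\<And>i. i \<in> L \<Longrightarrow> a i \<in> borel_measurable M"
    and b: "\<And>i. i \<in> L \<Longrightarrow> b i \<in> borel_measurable M'"
    and distr: "distr M' (Pi\<^sub>M L (\<lambda>_. borel)) (\<lambda>\<omega>. \<lambda>i\<in>L. b i \<omega>) =
      distr M (Pi\<^sub>M L (\<lambda>_. borel)) (\<lambda>\<omega>. \<lambda>i\<in>L. a i \<omega>)"
    and zero: "AE \<omega> in M. (\<Sum>i\<in>L. a i \<omega> * c i) = 0"
  shows "AE \<omega> in M'. (\<Sum>i\<in>L. b i \<omega> * c i) = 0"
proof -
  let ?P = "Pi\<^sub>M L (\<lambda>_. borel) :: ('i \<Rightarrow> complex) measure"
  have meas [measurable]: "Measurable.pred ?P (\<lambda>x. (\<Sum>i\<in>L. x i * c i) = 0)"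
    by measurable
  have a_meas: "(\<lambda>\<omega>. \<lambda>i\<in>L. a i \<omega>) \<in> measurable M ?P"
    using a by (intro measurable_restrict)
  have b_meas: "(\<lambda>\<omega>. \<lambda>i\<in>L. b i \<omega>) \<in> measurable M' ?P"
    using b by (intro measurable_restrict)
  have "AE x in distr M' ?P (\<lambda>\<omega>. \<lambda>i\<in>L. b i \<omega>). (\<Sum>i\<in>L. x i * c i) = 0"
    unfolding distr by (subst AE_distr_iff[OF a_meas]) (use zero meas in auto)
  then show ?thesis
    by (subst (asm) AE_distr_iff[OF b_meas]) (use meas in auto)
qed

section \<open>Moments of words and pairings\<close>

text \<open>The falling factorial \<open>n (n - 1) \<dots> (n - k + 1)\<close>; truncated subtraction is harmless, since the
product contains the factor \<open>0\<close> as soon as \<open>k > n\<close>.\<close>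

definition falling :: "nat \<Rightarrow> nat \<Rightarrow> nat" where
  "falling n k = (\<Prod>i<k. n - i)"

lemma falling_add: "falling n (k + l) = falling n k * falling (n - k) l"
  by (induction l) (simp_all add: falling_def mult.assoc)

lemma falling_Suc: "falling n (Suc k) = n * falling (n - 1) k"
  using falling_add[of n 1 k] by (simp add: falling_def)

lemma falling_asymptotics: "(\<lambda>N. real (falling N k) / real N ^ k) \<longlonglongrightarrow> 1"
proof -
  have "(\<lambda>N. real (N - i) / real N) \<longlonglongrightarrow> 1" for i
  proof (rule Lim_transform_eventually)
    have "(\<lambda>N. 1 - real i / real N) \<longlonglongrightarrow> 1 - 0"
      by (intro tendsto_diff tendsto_const lim_const_over_n)
    then show "(\<lambda>N. 1 - real i / real N) \<longlonglongrightarrow> 1" by simp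
    show "\<forall>\<^sub>F N in sequentially. 1 - real i / real N = real (N - i) / real N"
      using eventually_gt_at_top[of i]
      by eventually_elim (simp add: of_nat_diff diff_divide_distrib)
  qed
  then have "(\<lambda>N. \<Prod>i<k. real (N - i) / real N) \<longlonglongrightarrow> (\<Prod>i<k. 1)"
    by (intro tendsto_prod) auto
  then show ?thesis
    by (simp add: falling_def prod_dividef)
qed

text \<open>The data from which the moments of words are computed: random coefficients \<open>a\<close>, matrices \<open>X\<close>, and
free copies \<open>Y j\<close> of \<open>X\<close>. The letter \<open>(j, i)\<close> stands for the polynomial \<open>p i\<close> in the family \<open>Y j\<close>; allowing a
polynomial instead of a variable makes it possible to start from a family \<open>X\<close> that is not centred and
to centre it inside the polynomials.\<close>

locale word_moments =
  fixes M :: "'w measure" and a :: "'v \<Rightarrow> 'w \<Rightarrow> complex" and L :: "'v set"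
    and \<phi> :: "'a::star_algebra \<Rightarrow> complex" and X :: "'v \<Rightarrow> 'a^'d^'d"
    and \<psi> :: "'b::star_algebra \<Rightarrow> complex" and J :: "'j set" and Y :: "'j \<Rightarrow> 'v \<Rightarrow> 'b^'d^'d"
    and p :: "'v \<Rightarrow> (complex ^'d^'d, 'v) ncpoly"
  assumes finite_L: "finite L"
    and \<phi>: "star_prob_space \<phi>" and \<psi>: "star_prob_space \<psi>"
    and distr: "\<And>j. j \<in> J \<Longrightarrow> same_op_distr \<psi> \<phi> L (Y j) X"
    and free: "free_families \<psi> J L Y"
    and vars: "\<And>i. i \<in> L \<Longrightarrow> ncvars (p i) \<subseteq> L"
    and centred: "\<And>i. i \<in> L \<Longrightarrow> op_exp \<phi> (nceval X (p i)) = 0"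
begin

sublocale \<phi>: star_prob_space \<phi> by (rule \<phi>)
sublocale \<psi>: star_prob_space \<psi> by (rule \<psi>)

definition op_moment :: "('j \<times> 'v) list \<Rightarrow> complex ^'d^'d" where
  "op_moment w = op_exp \<psi> (word_eval Y (map (map_prod id p) w))"

text \<open>The contribution of a word to the moment of the sum.\<close>

definition moment :: "('j \<times> 'v) list \<Rightarrow> complex ^'d^'d" where
  "moment w = cscale (indep_moment M a w) (op_moment w)"

definition cov :: "'v \<Rightarrow> 'v \<Rightarrow> complex ^'d^'d \<Rightarrow> complex ^'d^'d" where
  "cov i i' B = op_exp \<phi> (nceval X (p i) ** membed B ** nceval X (p i'))"

text \<open>The covariance map \<open>B \<mapsto> \<bbbE>(E(Z B Z))\<close> of \<open>Z = \<Sum>\<^sub>i a\<^sub>i \<otimes> p\<^sub>i(X)\<close>, expanded over pairs of letters.\<close>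

definition eta :: "complex ^'d^'d \<Rightarrow> complex ^'d^'d" where
  "eta B = (\<Sum>i\<in>L. \<Sum>i'\<in>L. cscale (block_moment M a [i, i']) (cov i i' B))"

lemma cov_linear:
  "cov i i' (A + B) = cov i i' A + cov i i' B"
  "cov i i' 0 = 0"
  "cov i i' (cscale c A) = cscale c (cov i i' A)"
  by (simp_all add: cov_def membed_simps matrix_add_ldistrib matrix_add_rdistrib mscale_mult
      \<phi>.op_exp_add \<phi>.op_exp_mscale)

lemma cov_sum: "cov i i' (\<Sum>x\<in>A. f x) = (\<Sum>x\<in>A. cov i i' (f x))"
  by (induction A rule: infinite_finite_induct) (simp_all add: cov_linear)

lemma eta_linear:
  "eta (A + B) = eta A + eta B"
  "eta 0 = 0"
  "eta (cscale c A) = cscale c (eta A)"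
  by (simp_all add: eta_def cov_linear cscale_simps sum.distrib cscale_sum mult.commute)

lemma nceval_copy:
  assumes "j \<in> J" "ncvars q \<subseteq> L"
  shows "op_exp \<psi> (nceval (Y j) q) = op_exp \<phi> (nceval X q)"
  using distr[OF assms(1)] assms(2) by (auto simp: same_op_distr_def)

lemma valid_word_letters:
  assumes "set w \<subseteq> K \<times> L"
  shows "valid_word L K (map (map_prod id p) w)"
  using assms vars by (fastforce simp: valid_word_def)

lemma op_moment_centred_between:
  assumes "j \<in> J" "i \<in> L" "set u \<subseteq> (J - {j}) \<times> L" "set v \<subseteq> (J - {j}) \<times> L"
  shows "op_moment (u @ (j, i) # v) = 0"
  using free_centred_between[OF \<psi> free assms(1) vars[OF assms(2)] _
      valid_word_letters[OF assms(3)] valid_word_letters[OF assms(4)]]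
    nceval_copy[OF assms(1) vars[OF assms(2)]] centred[OF assms(2)]
  by (simp add: op_moment_def word_eval_append matrix_mul_assoc)

lemma op_moment_nested_pair:
  assumes j: "j \<in> J" and i: "i \<in> L" "i' \<in> L"
    and u: "set u \<subseteq> (J - {j}) \<times> L" and v: "set v \<subseteq> (J - {j}) \<times> L"
  shows "op_moment ((j, i) # u @ (j, i') # v) = cov i i' (op_moment u) ** op_moment v"
proof -
  let ?q = "NMul (NMul (p i) (NCoeff (op_moment u))) (p i')"
  have "op_exp \<psi> (nceval (Y j) ?q) = cov i i' (op_moment u)"
    using nceval_copy[OF j, of ?q] vars i by (simp add: cov_def)
  then show ?thesis
    using free_nested_pair[OF \<psi> free j vars[OF i(1)] _ vars[OF i(2)] _
        valid_word_letters[OF u] valid_word_letters[OF v]]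
      nceval_copy[OF j vars] centred i
    by (simp add: op_moment_def word_eval_append matrix_mul_assoc)
qed

text \<open>The word of operators factorises by freeness alone; disjointness of the indices of \<open>u\<close> and \<open>v\<close> makes
the classical moment factorise in the same way.\<close>

lemma moment_nested_pair:
  assumes "j \<in> J" "i \<in> L" "i' \<in> L" "set u \<subseteq> (J - {j}) \<times> L" "set v \<subseteq> (J - {j}) \<times> L"
    and "fst ` set u \<inter> fst ` set v = {}"
  shows "moment ((j, i) # u @ (j, i') # v) =
    cscale (block_moment M a [i, i']) (cov i i' (moment u)) ** moment v"
proof -
  have "j \<notin> fst ` set u" "j \<notin> fst ` set v"
    using assms(4,5) by auto
  from indep_moment_nested_pair[OF this assms(6), of M a i i'] op_moment_nested_pair[OF assms(1-5)]
  show ?thesis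
    by (simp add: moment_def cscale_simps cov_linear mult_ac)
qed

lemma moment_Nil [simp]: "moment [] = mat 1"
  by (simp add: moment_def op_moment_def cscale_simps)

text \<open>Renaming the indices gives a family that is free again and has the same individual distributions,
so the joint moments agree by \<open>free_joint_moments_unique\<close>.\<close>

lemma moment_relabel:
  assumes w: "set w \<subseteq> J \<times> L" and \<sigma>: "inj_on \<sigma> (fst ` set w)" "\<sigma> ` fst ` set w \<subseteq> J"
  shows "moment (map (map_prod \<sigma> id) w) = moment w"
proof -
  let ?K = "fst ` set w"
  have K: "?K \<subseteq> J" and wK: "set w \<subseteq> ?K \<times> L"
    using w by (auto intro: rev_image_eqI)
  have free_K: "free_families \<psi> ?K L Y"
    using free_families_relabel[OF free, of "\<lambda>j. j" ?K] K by simp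
  have free_\<sigma>: "free_families \<psi> ?K L (\<lambda>j. Y (\<sigma> j))"
    by (rule free_families_relabel[OF free \<sigma>])
  have "same_op_distr \<psi> \<psi> L (Y (\<sigma> j)) (Y j)" if "j \<in> ?K" for j
  proof -
    have "j \<in> J" "\<sigma> j \<in> J"
      using that K \<sigma>(2) by blast+
    then show ?thesis
      by (simp add: same_op_distr_def nceval_copy)
  qed
  from free_joint_moments_unique[OF \<psi> \<psi> free_\<sigma> free_K this valid_word_letters[OF wK]]
  have "op_exp \<psi> (word_eval (\<lambda>j. Y (\<sigma> j)) (map (map_prod id p) w)) = op_moment w"
    by (simp add: op_moment_def)
  moreover have "word_eval (\<lambda>j. Y (\<sigma> j)) (map (map_prod id p) w) =
      word_eval Y (map (map_prod id p) (map (map_prod \<sigma> id) w))"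
    by (simp add: word_eval_def case_prod_beta o_def)
  ultimately show ?thesis
    using \<sigma>(1) by (simp add: moment_def op_moment_def indep_moment_relabel del: map_map)
qed

definition words :: "'j set \<Rightarrow> nat \<Rightarrow> ('j \<times> 'v) list set" where
  "words I m = {w. set w \<subseteq> I \<times> L \<and> length w = m}"

definition pair_words :: "'j set \<Rightarrow> nat \<Rightarrow> ('j \<times> 'v) list set" where
  "pair_words I m = {w \<in> words I m. \<forall>j\<in>fst ` set w. count_list (map fst w) j = 2}"

lemma words_index: "w \<in> words I m \<Longrightarrow> fst ` set w \<subseteq> I"
  by (auto simp: words_def)

lemma words_mono: "I \<subseteq> I' \<Longrightarrow> words I m \<subseteq> words I' m"
  by (auto simp: words_def)

lemma pair_words_index: "w \<in> pair_words I m \<Longrightarrow> fst ` set w \<subseteq> I"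
  unfolding pair_words_def using words_index by blast

lemma pair_words_count:
  "w \<in> pair_words I m \<Longrightarrow> j \<in> fst ` set w \<Longrightarrow> count_list (map fst w) j = 2"
  unfolding pair_words_def by blast

lemma finite_words: "finite I \<Longrightarrow> finite (words I m)"
  unfolding words_def by (intro finite_lists_length_eq finite_cartesian_product finite_L)

lemma finite_pair_words: "finite I \<Longrightarrow> finite (pair_words I m)"
  by (simp add: pair_words_def finite_words)

lemma sum_count_list_word: "(\<Sum>j\<in>fst ` set w. count_list (map fst w) j) = length w"
  using sum_count_set[of "map fst w" "fst ` set w"] by simp

lemma card_pair_word: "w \<in> pair_words I m \<Longrightarrow> m = 2 * card (fst ` set w)"
proof -
  assume w: "w \<in> pair_words I m"
  then have "(\<Sum>j\<in>fst ` set w. count_list (map fst w) j) = (\<Sum>j\<in>fst ` set w. 2)"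
    by (intro sum.cong) (auto simp: pair_words_def)
  then show ?thesis
    using w sum_count_list_word[of w] by (simp add: pair_words_def words_def)
qed

lemma split_at_once:
  assumes "count_list (map fst w) j = 1"
  obtains u i v where "w = u @ (j, i) # v" "j \<notin> fst ` set u" "j \<notin> fst ` set v"
proof -
  have "j \<in> set (map fst w)"
    using assms count_notin[of j "map fst w"] by fastforce
  then obtain i where "(j, i) \<in> set w" by auto
  then obtain u v where w: "w = u @ (j, i) # v"
    by (meson split_list)
  then have "count_list (map fst u) j = 0" "count_list (map fst v) j = 0"
    using assms by simp_all
  then show ?thesis
    using that[OF w] by (simp add: count_list_0_iff)
qed

lemma op_moment_singleton:
  assumes w: "set w \<subseteq> J \<times> L" and one: "count_list (map fst w) j = 1"
  shows "op_moment w = 0"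
proof -
  obtain u i v where *: "w = u @ (j, i) # v" "j \<notin> fst ` set u" "j \<notin> fst ` set v"
    using split_at_once[OF one] .
  show ?thesis
    unfolding *(1) using w * by (intro op_moment_centred_between) (auto intro: rev_image_eqI)
qed

lemma pair_words_0: "pair_words I 0 = {[]}"
  by (auto simp: pair_words_def words_def)

lemma pair_words_1: "pair_words I (Suc 0) = {}"
proof -
  have "Suc 0 \<noteq> 2 * n" for n by presburger
  then show ?thesis
    using card_pair_word[of _ I "Suc 0"] by blast
qed

text \<open>The decomposition of a pair word at the second occurrence of its first index, without a crossing
between the two parts: \<open>nested_index\<close> lists the data, \<open>nested_word\<close> assembles the word. The length \<open>k\<close>
of the inner part is kept as a component so that the sum splits along the recursion of \<open>nc_sum\<close>.\<close>

definition nested_word :: "nat \<times> 'j \<times> 'v \<times> 'v \<times> ('j \<times> 'v) list \<times> ('j \<times> 'v) list \<Rightarrow> ('j \<times> 'v) list"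
  where "nested_word = (\<lambda>(k, j, i, i', u, v). (j, i) # u @ (j, i') # v)"

definition nested_index ::
    "'j set \<Rightarrow> nat \<Rightarrow> (nat \<times> 'j \<times> 'v \<times> 'v \<times> ('j \<times> 'v) list \<times> ('j \<times> 'v) list) set" where
  "nested_index I m = (SIGMA k:{..m}. SIGMA j:I. SIGMA i:L. SIGMA i':L. SIGMA u:pair_words (I - {j}) k.
     pair_words (I - {j} - fst ` set u) (m - k))"

lemma nested_word_in_pair_words:
  assumes "t \<in> nested_index I m"
  shows "nested_word t \<in> pair_words I (Suc (Suc m))"
proof -
  obtain k j i i' u v where t: "t = (k, j, i, i', u, v)" and k: "k \<le> m" and j: "j \<in> I"
    and i: "i \<in> L" "i' \<in> L" and u: "u \<in> pair_words (I - {j}) k"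
    and v: "v \<in> pair_words (I - {j} - fst ` set u) (m - k)"
    using assms by (auto simp: nested_index_def)
  have jn: "j \<notin> fst ` set u" "j \<notin> fst ` set v" and uv: "fst ` set u \<inter> fst ` set v = {}"
    using pair_words_index[OF u] pair_words_index[OF v] by blast+
  have "count_list (map fst (nested_word t)) x = 2" if "x \<in> fst ` set (nested_word t)" for x
  proof -
    consider "x = j" | "x \<noteq> j" "x \<in> fst ` set u" "x \<notin> fst ` set v"
      | "x \<noteq> j" "x \<notin> fst ` set u" "x \<in> fst ` set v"
      using \<open>x \<in> fst ` set (nested_word t)\<close> uv by (auto simp: t nested_word_def)
    then show ?thesis
      using jn pair_words_count[OF u] pair_words_count[OF v]
      by cases (simp_all add: t nested_word_def)
  qed
  moreover have "nested_word t \<in> words I (Suc (Suc m))"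
    using u v k j i by (auto simp: t nested_word_def pair_words_def words_def)
  ultimately show ?thesis
    unfolding pair_words_def by blast
qed

lemma inj_on_nested_word: "inj_on nested_word (nested_index I m)"
proof (rule inj_onI)
  fix s t assume s: "s \<in> nested_index I m" and t: "t \<in> nested_index I m"
    and eq: "nested_word s = nested_word t"
  obtain k j i i' u v where s': "s = (k, j, i, i', u, v)" and "length u = k" "\<forall>x\<in>set u. fst x \<noteq> j"
    using s by (fastforce simp: nested_index_def pair_words_def words_def)
  obtain l y x x' r q where t': "t = (l, y, x, x', r, q)" and "length r = l" "\<forall>z\<in>set r. fst z \<noteq> y"
    using t by (fastforce simp: nested_index_def pair_words_def words_def)
  have "y = j" "i = x" and tl: "u @ (j, i') # v = r @ (j, x') # q"
    using eq by (auto simp: s' t' nested_word_def)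
  have "takeWhile (\<lambda>z. fst z \<noteq> j) (u @ (j, i') # v) = u"
    using \<open>\<forall>x\<in>set u. fst x \<noteq> j\<close> by (subst takeWhile_append2) auto
  moreover have "takeWhile (\<lambda>z. fst z \<noteq> j) (r @ (j, x') # q) = r"
    using \<open>\<forall>z\<in>set r. fst z \<noteq> y\<close> \<open>y = j\<close> by (subst takeWhile_append2) auto
  ultimately have "u = r"
    using tl by simp
  then show "s = t"
    using tl \<open>y = j\<close> \<open>i = x\<close> \<open>length u = k\<close> \<open>length r = l\<close> by (simp add: s' t')
qed

text \<open>Cut the word at the second occurrence of its first index. If the two parts share an index, this
index occurs once in each of them, and the inner part has expectation zero.\<close>

lemma moment_crossing_pair_word:
  assumes I: "I \<subseteq> J" and w: "w \<in> pair_words I (Suc (Suc m))"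
    and crossing: "w \<notin> nested_word ` nested_index I m"
  shows "moment w = 0"
proof -
  obtain j i w' where w': "w = (j, i) # w'"
    using w by (cases w) (auto simp: pair_words_def words_def)
  have count: "count_list (map fst w) x = 2" if "x \<in> fst ` set w" for x
    using w that by (auto simp: pair_words_def)
  have "count_list (map fst w') j = 1"
    using count[of j] by (simp add: w')
  then obtain u i' v where uv: "w' = u @ (j, i') # v" and j: "j \<notin> fst ` set u" "j \<notin> fst ` set v"
    using split_at_once by metis
  have sets: "j \<in> I" "i \<in> L" "i' \<in> L" "set u \<subseteq> (I - {j}) \<times> L" "set v \<subseteq> (I - {j}) \<times> L"
    using w j by (auto simp: w' uv pair_words_def words_def intro: rev_image_eqI)
  have len: "length u + length v = m"
    using w by (auto simp: w' uv pair_words_def words_def)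
  have count_uv: "count_list (map fst u) x + count_list (map fst v) x = 2"
    if "x \<in> fst ` set u \<union> fst ` set v" for x
  proof -
    have "x \<noteq> j" using that j by auto
    then show ?thesis
      using count[of x] that by (auto simp: w' uv)
  qed
  have "fst ` set u \<inter> fst ` set v \<noteq> {}"
  proof
    assume disj: "fst ` set u \<inter> fst ` set v = {}"
    have cu: "count_list (map fst u) x = 2" if "x \<in> fst ` set u" for x
    proof -
      have "x \<notin> fst ` set v"
        using that disj by blast
      then show ?thesis
        using count_uv[of x] that by simp
    qed
    have cv: "count_list (map fst v) x = 2" if "x \<in> fst ` set v" for x
    proof -
      have "x \<notin> fst ` set u"
        using that disj by blast
      then show ?thesis
        using count_uv[of x] that by simp
    qed
    have sv: "set v \<subseteq> (I - {j} - fst ` set u) \<times> L"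
    proof
      fix z assume z: "z \<in> set v"
      then have "fst z \<notin> fst ` set u"
        using disj by blast
      moreover have "z \<in> (I - {j}) \<times> L"
        using sets(5) z by blast
      ultimately show "z \<in> (I - {j} - fst ` set u) \<times> L"
        by (simp only: mem_Times_iff Diff_iff simp_thms)
    qed
    have "u \<in> pair_words (I - {j}) (length u)"
      unfolding pair_words_def words_def using sets(4) cu by blast
    moreover have "v \<in> pair_words (I - {j} - fst ` set u) (length v)"
      unfolding pair_words_def words_def using sv cv by blast
    moreover have "length v = m - length u" "length u \<le> m"
      using len by auto
    ultimately have "(length u, j, i, i', u, v) \<in> nested_index I m"
      using sets(1-3) by (simp add: nested_index_def)
    moreover have "w = nested_word (length u, j, i, i', u, v)"
      by (simp add: nested_word_def w' uv)
    ultimately show False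
      using crossing by blast
  qed
  then obtain x where x: "x \<in> fst ` set u" "x \<in> fst ` set v" by blast
  have "count_list (map fst u) x \<noteq> 0" "count_list (map fst v) x \<noteq> 0"
    using x by (auto simp: count_list_0_iff)
  then have "count_list (map fst u) x = 1"
    using count_uv[of x] x(1) by simp
  then have "op_moment u = 0"
    using sets I by (intro op_moment_singleton[of u x]) auto
  moreover have "op_moment w = cov i i' (op_moment u) ** op_moment v"
    unfolding w' uv using sets I by (intro op_moment_nested_pair) auto
  ultimately show ?thesis
    by (simp add: moment_def cov_linear cscale_simps)
qed

lemma nc_sum_eta_odd: "odd m \<Longrightarrow> nc_sum eta m = 0"
proof (induction m rule: less_induct)
  case (less m)
  show ?case
  proof (cases "m = 1")
    case False
    with less.prems obtain n where m: "m = Suc (Suc n)"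
      by (metis One_nat_def even_zero not0_implies_Suc)
    have "eta (nc_sum eta k) ** nc_sum eta (n - k) = 0" if "k \<le> n" for k
    proof (cases "odd k")
      case True
      then show ?thesis using less.IH[of k] m that by (simp add: eta_linear)
    next
      case False
      then show ?thesis using less.IH[of "n - k"] less.prems m that by simp
    qed
    then show ?thesis by (simp add: m)
  qed simp
qed

text \<open>For the nested decomposition there are \<open>|I|\<close> choices of the first index; the inner part then takes
its indices from the remaining ones, and the outer part from those left over by the inner part. The
numbers of choices multiply to the falling factorial whatever the split, so no limit is needed.\<close>

lemma sum_moment_pair_words:
  assumes "finite I" "I \<subseteq> J"
  shows "(\<Sum>w\<in>pair_words I m. moment w) =
    cscale (of_nat (falling (card I) (m div 2))) (nc_sum eta m)"
  using assms
proof (induction m arbitrary: I rule: less_induct)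
  case (less m)
  consider "m = 0" | "m = 1" | n where "m = Suc (Suc n)"
    by (metis One_nat_def not0_implies_Suc)
  then show ?case
  proof cases
    case 1
    then show ?thesis by (simp add: pair_words_0 falling_def cscale_simps)
  next
    case 2
    then show ?thesis by (simp add: pair_words_1 cscale_simps)
  next
    case 3
    have fin: "finite (pair_words (I - A) k)" "finite (pair_words (I - A - B) k)" for A B k
      using less.prems(1) by (simp_all add: finite_pair_words)
    define c where "c = (\<lambda>k. falling (card I - 1) (k div 2))"
    define d where "d = (\<lambda>k. falling (card I - 1 - k div 2) ((n - k) div 2))"
    have "(\<Sum>w\<in>pair_words I m. moment w) = (\<Sum>w\<in>nested_word ` nested_index I n. moment w)"
      unfolding 3 using moment_crossing_pair_word[OF less.prems(2)] nested_word_in_pair_words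
      by (intro sum.mono_neutral_right finite_pair_words less.prems(1)) auto
    also have "\<dots> = (\<Sum>t\<in>nested_index I n. moment (nested_word t))"
      by (simp add: sum.reindex[OF inj_on_nested_word])
    also have "\<dots> = (\<Sum>(k, j, i, i', u, v)\<in>nested_index I n.
        cscale (block_moment M a [i, i']) (cov i i' (moment u)) ** moment v)"
    proof (rule sum.cong[OF refl], clarify)
      fix k j i i' u v assume t: "(k, j, i, i', u, v) \<in> nested_index I n"
      show "moment (nested_word (k, j, i, i', u, v)) =
          cscale (block_moment M a [i, i']) (cov i i' (moment u)) ** moment v"
        unfolding nested_word_def prod.case
        by (rule moment_nested_pair)
          (use t less.prems(2) in \<open>fastforce simp: nested_index_def pair_words_def words_def\<close>)+
    qed
    also have "\<dots> = (\<Sum>k\<le>n. \<Sum>j\<in>I. \<Sum>i\<in>L. \<Sum>i'\<in>L. \<Sum>u\<in>pair_words (I - {j}) k.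
        \<Sum>v\<in>pair_words (I - {j} - fst ` set u) (n - k).
          cscale (block_moment M a [i, i']) (cov i i' (moment u)) ** moment v)"
      unfolding nested_index_def
      by (simp add: sum.Sigma less.prems(1) finite_L fin)
    also have "\<dots> = (\<Sum>k\<le>n. \<Sum>j\<in>I. \<Sum>i\<in>L. \<Sum>i'\<in>L. \<Sum>u\<in>pair_words (I - {j}) k.
        cscale (block_moment M a [i, i']) (cov i i' (moment u)) **
          cscale (of_nat (d k)) (nc_sum eta (n - k)))"
    proof (intro sum.cong[OF refl])
      fix k j i i' u assume k: "k \<in> {..n}" and j: "j \<in> I" and u: "u \<in> pair_words (I - {j}) k"
      have "fst ` set u \<subseteq> I - {j}"
        using u by (auto simp: pair_words_def words_def)
      moreover have "card (fst ` set u) = k div 2"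
        using card_pair_word[OF u] by simp
      ultimately have "card (I - {j} - fst ` set u) = card I - 1 - k div 2"
        using j less.prems(1) by (simp add: card_Diff_subset)
      moreover have "n - k < m" using 3 by simp
      ultimately have "(\<Sum>v\<in>pair_words (I - {j} - fst ` set u) (n - k). moment v) =
          cscale (of_nat (d k)) (nc_sum eta (n - k))"
        using less.IH[of "n - k" "I - {j} - fst ` set u"] less.prems by (simp add: d_def subset_eq)
      then show "(\<Sum>v\<in>pair_words (I - {j} - fst ` set u) (n - k).
          cscale (block_moment M a [i, i']) (cov i i' (moment u)) ** moment v) =
        cscale (block_moment M a [i, i']) (cov i i' (moment u)) **
          cscale (of_nat (d k)) (nc_sum eta (n - k))"
        by (simp flip: matrix_mult_sum(1))
    qed
    also have "\<dots> = (\<Sum>k\<le>n. \<Sum>j\<in>I. \<Sum>i\<in>L. \<Sum>i'\<in>L.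
        cscale (block_moment M a [i, i']) (cov i i' (cscale (of_nat (c k)) (nc_sum eta k))) **
          cscale (of_nat (d k)) (nc_sum eta (n - k)))"
    proof (intro sum.cong[OF refl])
      fix k j i i' assume k: "k \<in> {..n}" and j: "j \<in> I"
      have "(\<Sum>u\<in>pair_words (I - {j}) k. moment u) = cscale (of_nat (c k)) (nc_sum eta k)"
        using less.IH[of k "I - {j}"] less.prems j k 3 by (auto simp: c_def)
      then show "(\<Sum>u\<in>pair_words (I - {j}) k. cscale (block_moment M a [i, i']) (cov i i' (moment u)) **
          cscale (of_nat (d k)) (nc_sum eta (n - k))) =
        cscale (block_moment M a [i, i']) (cov i i' (cscale (of_nat (c k)) (nc_sum eta k))) **
          cscale (of_nat (d k)) (nc_sum eta (n - k))"
        by (simp only: flip: matrix_mult_sum(2) cscale_sum cov_sum)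
    qed
    also have "\<dots> = (\<Sum>k\<le>n. \<Sum>j\<in>I. eta (cscale (of_nat (c k)) (nc_sum eta k)) **
          cscale (of_nat (d k)) (nc_sum eta (n - k)))"
      by (simp only: eta_def matrix_mult_sum(2))
    also have "\<dots> = (\<Sum>k\<le>n. cscale (of_nat (card I)) (eta (cscale (of_nat (c k)) (nc_sum eta k)) **
          cscale (of_nat (d k)) (nc_sum eta (n - k))))"
    proof (rule sum.cong[OF refl])
      fix k
      have const: "(\<Sum>j\<in>I. A) = cscale (of_nat (card I)) A" for A :: "complex ^'d^'d"
        using less.prems(1) by induction (simp_all add: cscale_simps del: sum_constant)
      show "(\<Sum>j\<in>I. eta (cscale (of_nat (c k)) (nc_sum eta k)) **
          cscale (of_nat (d k)) (nc_sum eta (n - k))) =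
        cscale (of_nat (card I)) (eta (cscale (of_nat (c k)) (nc_sum eta k)) **
          cscale (of_nat (d k)) (nc_sum eta (n - k)))"
        by (rule const)
    qed
    also have "\<dots> = (\<Sum>k\<le>n. cscale (of_nat (falling (card I) (m div 2)))
        (eta (nc_sum eta k) ** nc_sum eta (n - k)))"
    proof (rule sum.cong[OF refl])
      fix k assume k: "k \<in> {..n}"
      show "cscale (of_nat (card I)) (eta (cscale (of_nat (c k)) (nc_sum eta k)) **
          cscale (of_nat (d k)) (nc_sum eta (n - k))) =
        cscale (of_nat (falling (card I) (m div 2))) (eta (nc_sum eta k) ** nc_sum eta (n - k))"
      \<comment> \<open>For odd \<open>k\<close> the falling factorials do not combine, but then \<open>nc_sum eta k = 0\<close>.\<close>
      proof (cases "even k")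
        case True
        then have "m div 2 = Suc (k div 2 + (n - k) div 2)"
          using 3 k by (auto elim!: evenE)
        then have "falling (card I) (m div 2) = card I * (c k * d k)"
          by (simp only: falling_Suc falling_add c_def d_def)
        then show ?thesis
          by (simp add: eta_linear cscale_simps mult_ac)
      next
        case False
        then show ?thesis
          by (simp add: nc_sum_eta_odd eta_linear cscale_simps)
      qed
    qed
    also have "\<dots> = cscale (of_nat (falling (card I) (m div 2))) (nc_sum eta m)"
      by (simp add: 3 cscale_sum)
    finally show ?thesis .
  qed
qed

end

section \<open>The limit of the normalised sum of moments\<close>

context word_moments
begin

text \<open>A word of length \<open>m\<close> has at most \<open>m\<close> indices, so all of them can be renamed into one fixed set of size
\<open>m\<close>. Hence there are only finitely many values.\<close>

lemma moment_bounded: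
  assumes "infinite J"
  shows "\<exists>C\<ge>0. \<forall>w\<in>words J m. norm (moment w) \<le> C"
proof -
  obtain K where K: "finite K" "card K = m" "K \<subseteq> J"
    using infinite_arbitrarily_large[OF assms] by blast
  have in_K: "moment w \<in> moment ` words K m" if w: "w \<in> words J m" for w
  proof -
    have "card (fst ` set w) \<le> card K"
      using w K(2) card_image_le[of "set w" fst] card_length[of w] by (auto simp: words_def)
    then obtain \<sigma> where \<sigma>: "\<sigma> ` fst ` set w \<subseteq> K" "inj_on \<sigma> (fst ` set w)"
      using card_le_inj[of "fst ` set w" K] K(1) by auto
    have "map (map_prod \<sigma> id) w \<in> words K m"
      using w \<sigma>(1) by (fastforce simp: words_def)
    moreover have "moment (map (map_prod \<sigma> id) w) = moment w"
      using w \<sigma> K(3) by (intro moment_relabel) (auto simp: words_def)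
    ultimately show ?thesis
      by (metis imageI)
  qed
  have "finite (norm ` moment ` words K m)"
    using finite_words[OF K(1)] by simp
  then obtain C where C: "\<And>x. x \<in> norm ` moment ` words K m \<Longrightarrow> x \<le> C"
    by (meson bdd_above_finite bdd_above.E)
  have "norm (moment w) \<le> max C 0" if "w \<in> words J m" for w
    using C in_K[OF that] by (auto intro: max.coboundedI1)
  then show ?thesis
    by (intro exI[of _ "max C 0"]) auto
qed

text \<open>No index occurs exactly once, and not all occur exactly twice, so the multiplicities add up to
more than twice the number of indices.\<close>

lemma moment_unpaired_few_indices:
  assumes "I \<subseteq> J" and w: "w \<in> words I m" and "w \<notin> pair_words I m" and "moment w \<noteq> 0"
  shows "2 * card (fst ` set w) < m"
proof -
  let ?c = "count_list (map fst w)"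
  have wJ: "set w \<subseteq> J \<times> L"
    using words_mono[OF assms(1)] w unfolding words_def by blast
  have ge2: "2 \<le> ?c j" if "j \<in> fst ` set w" for j
  proof -
    have "?c j \<noteq> 0"
      using that by (simp add: count_list_0_iff)
    moreover have "?c j \<noteq> 1"
      using op_moment_singleton[OF wJ, of j] assms(4) by (auto simp: moment_def cscale_simps)
    ultimately show ?thesis by linarith
  qed
  obtain j where "j \<in> fst ` set w" "?c j \<noteq> 2"
    using assms by (auto simp: pair_words_def)
  then have "\<exists>j\<in>fst ` set w. 2 < ?c j"
    using ge2[of j] by (intro bexI[of _ j]) simp_all
  then have "(\<Sum>j\<in>fst ` set w. 2) < (\<Sum>j\<in>fst ` set w. ?c j)"
    using ge2 by (intro sum_strict_mono_ex1) blast+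
  then show ?thesis
    using w by (simp add: sum_count_list_word words_def mult.commute)
qed

text \<open>Such a word is obtained from a list of \<open>(m - 1) div 2\<close> indices and a word in positions of that list.\<close>

lemma card_words_few_indices:
  assumes I: "finite I"
  shows "card {w \<in> words I m. 2 * card (fst ` set w) < m} \<le>
    card I ^ ((m - 1) div 2) * ((m - 1) div 2 * card L) ^ m"
proof -
  let ?r = "(m - 1) div 2"
  let ?A = "{xs. set xs \<subseteq> I \<and> length xs = ?r}"
  let ?B = "{w. set w \<subseteq> {..<?r} \<times> L \<and> length w = m}"
  let ?f = "\<lambda>(xs, w). map (map_prod (nth xs) id) w"
  have "w \<in> ?f ` (?A \<times> ?B)" if w: "w \<in> words I m" and few: "2 * card (fst ` set w) < m" for w
  proof -
    obtain ys where ys: "set ys = fst ` set w" "distinct ys"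
      using finite_distinct_list[of "fst ` set w"] by auto
    have "length ys \<le> ?r"
      using few distinct_card[OF ys(2)] ys(1) by auto
    obtain x where x: "x \<in> I"
      using w few words_index[OF w] by (cases w) (auto simp: words_def)
    \<comment> \<open>Padding with an arbitrary index gives lists of one fixed length.\<close>
    define xs where "xs = ys @ replicate (?r - length ys) x"
    have xs: "length xs = ?r" "set xs \<subseteq> I" "fst ` set w \<subseteq> set xs"
      using \<open>length ys \<le> ?r\<close> ys(1) words_index[OF w] x by (auto simp: xs_def)
    have "\<exists>k<?r. xs ! k = j" if "j \<in> fst ` set w" for j
      using that xs(1,3) by (metis in_set_conv_nth subsetD)
    then obtain g where g: "g j < ?r" "xs ! g j = j" if "j \<in> fst ` set w" for j
      by metis
    have "map (map_prod (nth xs) id) (map (map_prod g id) w) = w"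
      unfolding map_map
    proof (rule map_idI)
      fix l assume "l \<in> set w"
      then have "xs ! g (fst l) = fst l"
        by (intro g(2)) simp
      then show "(map_prod (nth xs) id \<circ> map_prod g id) l = l"
        by (cases l) simp
    qed
    moreover have "map (map_prod g id) w \<in> ?B"
      using w g(1) by (fastforce simp: words_def)
    ultimately show ?thesis
      using xs by (intro image_eqI[where x = "(xs, map (map_prod g id) w)"]) auto
  qed
  then have "{w \<in> words I m. 2 * card (fst ` set w) < m} \<subseteq> ?f ` (?A \<times> ?B)"
    by blast
  moreover have fin: "finite ?A" "finite ?B"
    using I by (auto intro!: finite_lists_length_eq finite_cartesian_product finite_L)
  ultimately have "card {w \<in> words I m. 2 * card (fst ` set w) < m} \<le> card (?A \<times> ?B)"
    by (intro surj_card_le) auto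
  also have "\<dots> = card I ^ ?r * (?r * card L) ^ m"
    using I finite_L by (simp add: card_cartesian_product card_lists_length_eq)
  finally show ?thesis .
qed

lemma norm_sum_unpaired_moments:
  assumes "infinite J"
  shows "\<exists>C. \<forall>I. finite I \<longrightarrow> I \<subseteq> J \<longrightarrow>
    norm (\<Sum>w\<in>words I m - pair_words I m. moment w) \<le> C * real (card I) ^ ((m - 1) div 2)"
proof -
  let ?r = "(m - 1) div 2"
  obtain C where C: "C \<ge> 0" "\<And>w. w \<in> words J m \<Longrightarrow> norm (moment w) \<le> C"
    using moment_bounded[OF assms] by blast
  have "norm (\<Sum>w\<in>words I m - pair_words I m. moment w)
      \<le> C * real ((?r * card L) ^ m) * real (card I) ^ ?r" if I: "finite I" "I \<subseteq> J" for I
  proof -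
    let ?F = "{w \<in> words I m. 2 * card (fst ` set w) < m}"
    have fin: "finite (words I m)"
      by (rule finite_words[OF I(1)])
    have "(\<Sum>w\<in>words I m - pair_words I m. moment w)
        = (\<Sum>w\<in>{w \<in> words I m - pair_words I m. moment w \<noteq> 0}. moment w)"
      using fin by (intro sum.mono_neutral_right) auto
    also have "norm \<dots> \<le> real (card {w \<in> words I m - pair_words I m. moment w \<noteq> 0}) * C"
      using C(2) words_mono[OF I(2)] by (intro sum_norm_bound) blast
    also have "\<dots> \<le> real (card ?F) * C"
      using moment_unpaired_few_indices[OF I(2)] fin C(1)
      by (intro mult_right_mono of_nat_mono card_mono) auto
    also have "\<dots> \<le> real (card I ^ ?r * (?r * card L) ^ m) * C"
      using card_words_few_indices[OF I(1)] C(1) by (intro mult_right_mono of_nat_mono) auto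
    finally show ?thesis
      by (simp add: mult_ac)
  qed
  then show ?thesis by blast
qed

lemma sum_moment_words_limit:
  assumes "infinite J" and I: "\<And>N. finite (I N)" "\<And>N. I N \<subseteq> J" "\<And>N. card (I N) = N"
  shows "(\<lambda>N. cscale (complex_of_real (1 / sqrt (real N)) ^ m) (\<Sum>w\<in>words (I N) m. moment w))
    \<longlonglongrightarrow> nc_sum eta m"
proof -
  define s where "s = (\<lambda>N. (1 / sqrt (real N)) ^ m)"
  define R where "R = (\<lambda>N. \<Sum>w\<in>words (I N) m - pair_words (I N) m. moment w)"
  have "cscale (complex_of_real (1 / sqrt (real N)) ^ m) (\<Sum>w\<in>words (I N) m. moment w) =
      (s N * real (falling N (m div 2))) *\<^sub>R nc_sum eta m + s N *\<^sub>R R N" for N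
  proof -
    have "(\<Sum>w\<in>words (I N) m. moment w) = (\<Sum>w\<in>pair_words (I N) m. moment w) + R N"
      unfolding R_def add.commute[of "sum moment (pair_words (I N) m)"]
      by (intro sum.subset_diff finite_words I) (auto simp: pair_words_def)
    also have "(\<Sum>w\<in>pair_words (I N) m. moment w) =
        real (falling N (m div 2)) *\<^sub>R nc_sum eta m"
      using sum_moment_pair_words[OF I(1,2)] I(3) by (simp flip: cscale_of_real)
    finally have "(\<Sum>w\<in>words (I N) m. moment w) =
        real (falling N (m div 2)) *\<^sub>R nc_sum eta m + R N" .
    moreover have "cscale (complex_of_real (1 / sqrt (real N)) ^ m) A = s N *\<^sub>R A" for A :: "complex ^'d^'d"
      unfolding s_def by (simp only: flip: cscale_of_real of_real_power)
    ultimately show ?thesis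
      by (simp add: scaleR_add_right)
  qed
  moreover have "(\<lambda>N. (s N * real (falling N (m div 2))) *\<^sub>R nc_sum eta m) \<longlonglongrightarrow> nc_sum eta m"
  proof (cases "even m")
    case True
    then obtain q where m: "m = 2 * q" by (elim evenE)
    have "s N = 1 / real N ^ q" for N
      by (simp add: s_def m power_mult power_divide)
    then have "(\<lambda>N. s N * real (falling N (m div 2))) \<longlonglongrightarrow> 1"
      using falling_asymptotics[of q] by (simp add: m)
    from tendsto_scaleR[OF this tendsto_const[of "nc_sum eta m"]] show ?thesis by simp
  next
    case False
    then show ?thesis by (simp add: nc_sum_eta_odd)
  qed
  moreover have "(\<lambda>N. s N *\<^sub>R R N) \<longlonglongrightarrow> 0"
  proof (cases "m = 0")
    case True
    have "words K 0 = {[]}" for K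
      by (auto simp: words_def)
    with True have "R N = 0" for N
      by (simp add: R_def pair_words_0)
    then show ?thesis by simp
  next
    case False
    let ?r = "(m - 1) div 2"
    obtain C where C: "\<And>N. norm (R N) \<le> C * real N ^ ?r"
      using norm_sum_unpaired_moments[OF assms(1), of m] I unfolding R_def by metis
    have bound: "norm (s N *\<^sub>R R N) \<le> C * (1 / sqrt (real N))" if N: "N \<ge> 1" for N
    proof -
      \<comment> \<open>The at most \<open>(m - 1) div 2\<close> indices leave at least one factor \<open>N\<^sup>-\<^sup>1\<^sup>/\<^sup>2\<close> of the normalisation.\<close>
      have "2 * ?r + 1 \<le> m"
        using False by linarith
      then have "s N \<le> (1 / sqrt (real N)) ^ (2 * ?r + 1)"
        unfolding s_def using N by (intro power_decreasing) auto
      also have "\<dots> = 1 / real N ^ ?r * (1 / sqrt (real N))"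
        by (simp add: power_add power_mult power_divide)
      finally have "s N * norm (R N) \<le> (1 / real N ^ ?r * (1 / sqrt (real N))) * (C * real N ^ ?r)"
        using C by (intro mult_mono) auto
      also have "\<dots> = C * (1 / sqrt (real N))"
        using N by simp
      finally show ?thesis
        by (simp add: s_def)
    qed
    have "(\<lambda>N. 1 / sqrt (real N)) \<longlonglongrightarrow> 0"
      by (intro tendsto_divide_0[OF tendsto_const] filterlim_at_top_imp_at_infinity
          filterlim_compose[OF sqrt_at_top] filterlim_real_sequentially)
    then have "(\<lambda>N. C * (1 / sqrt (real N))) \<longlonglongrightarrow> 0"
      by (rule tendsto_mult_right_zero)
    then show ?thesis
      by (rule Lim_null_comparison[rotated])
        (use bound in \<open>auto simp: eventually_sequentially intro!: exI[of _ 1]\<close>)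
  qed
  ultimately show ?thesis
    using tendsto_add by fastforce
qed

end

section \<open>Expectations of random operator-valued matrices\<close>

text \<open>Equality in the tensor product holds almost everywhere only, and the integral of a non-measurable
function is \<open>0\<close> by convention; so representatives have to be known to be measurable before they are
replaced. This class of representatives is closed under the algebra operations.\<close>

inductive measurable_tensor :: "'w measure \<Rightarrow> ('w \<Rightarrow> 'a::star_algebra ^'d^'d) \<Rightarrow> bool"
  for M where
  simple: "f \<in> borel_measurable M \<Longrightarrow> measurable_tensor M (\<lambda>\<omega>. mscale (f \<omega>) V)"
| add: "measurable_tensor M W \<Longrightarrow> measurable_tensor M W' \<Longrightarrow> measurable_tensor M (\<lambda>\<omega>. W \<omega> + W' \<omega>)"

lemma measurable_tensor_const: "measurable_tensor M (\<lambda>_. V)"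
  using measurable_tensor.simple[of "\<lambda>_. 1" M V] by (simp add: mscale_simps)

lemma measurable_tensor_sum:
  assumes "\<And>i. i \<in> I \<Longrightarrow> measurable_tensor M (W i)"
  shows "measurable_tensor M (\<lambda>\<omega>. \<Sum>i\<in>I. W i \<omega>)"
  using assms
  by (induction I rule: infinite_finite_induct)
    (simp_all add: measurable_tensor_const measurable_tensor.add)

lemma measurable_tensor_mult:
  assumes "measurable_tensor M W" "measurable_tensor M W'"
  shows "measurable_tensor M (\<lambda>\<omega>. W \<omega> ** W' \<omega>)"
  using assms
proof (induction arbitrary: W')
  case (simple f V)
  from simple(2) show ?case
  proof induction
    case (simple g V')
    then have "measurable_tensor M (\<lambda>\<omega>. mscale (f \<omega> * g \<omega>) (V ** V'))"
      using \<open>f \<in> borel_measurable M\<close> by (intro measurable_tensor.simple) simp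
    moreover have "mscale (f \<omega>) V ** mscale (g \<omega>) V' = mscale (f \<omega> * g \<omega>) (V ** V')" for \<omega>
      by (simp add: mscale_mult mscale_simps mult.commute)
    ultimately show ?case by simp
  next
    case (add W W')
    then show ?case by (simp add: matrix_add_ldistrib measurable_tensor.add)
  qed
next
  case (add W1 W2)
  then show ?case by (simp add: matrix_add_rdistrib measurable_tensor.add)
qed

lemma measurable_tensor_mpow: "measurable_tensor M W \<Longrightarrow> measurable_tensor M (\<lambda>\<omega>. mpow (W \<omega>) m)"
  by (induction m) (simp_all add: measurable_tensor_const measurable_tensor_mult)

lemma measurable_tensor_random_op_matrix:
  "Z \<in> random_op_matrices M \<Longrightarrow> measurable_tensor M Z"
  by (auto simp: random_op_matrices_def tsum_def Linf_minus_def
      intro!: measurable_tensor_sum measurable_tensor.simple)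

lemma measurable_op_exp:
  assumes "star_prob_space \<phi>" "measurable_tensor M W"
  shows "(\<lambda>\<omega>. op_exp \<phi> (W \<omega>) $ k $ l) \<in> borel_measurable M"
  using assms(2)
proof induction
  interpret star_prob_space \<phi> by fact
  {
    case (simple f V)
    then show ?case by (simp add: op_exp_mscale cscale_def)
  next
    case (add W W')
    then show ?case by (simp add: op_exp_add)
  }
qed

lemma total_exp_sum:
  assumes \<phi>: "star_prob_space \<phi>" and W: "measurable_tensor M W"
    and eq: "AE \<omega> in M. W \<omega> = (\<Sum>s\<in>S. mscale (f s \<omega>) (V s))"
    and f: "\<And>s. s \<in> S \<Longrightarrow> integrable M (f s)"
  shows "total_exp M \<phi> W = (\<Sum>s\<in>S. cscale (\<integral>\<omega>. f s \<omega> \<partial>M) (op_exp \<phi> (V s)))"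
proof -
  interpret star_prob_space \<phi> by fact
  have "(\<integral>\<omega>. op_exp \<phi> (W \<omega>) $ k $ l \<partial>M) =
      (\<Sum>s\<in>S. (\<integral>\<omega>. f s \<omega> \<partial>M) * op_exp \<phi> (V s) $ k $ l)" for k l
  proof -
    have "(\<integral>\<omega>. op_exp \<phi> (W \<omega>) $ k $ l \<partial>M) = (\<integral>\<omega>. (\<Sum>s\<in>S. f s \<omega> * op_exp \<phi> (V s) $ k $ l) \<partial>M)"
    proof (rule integral_cong_AE)
      show "AE \<omega> in M. op_exp \<phi> (W \<omega>) $ k $ l = (\<Sum>s\<in>S. f s \<omega> * op_exp \<phi> (V s) $ k $ l)"
        using eq by eventually_elim (simp add: op_exp_sum op_exp_mscale cscale_def)
      show "(\<lambda>\<omega>. \<Sum>s\<in>S. f s \<omega> * op_exp \<phi> (V s) $ k $ l) \<in> borel_measurable M"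
        using f by (intro borel_measurable_sum borel_measurable_times borel_measurable_integrable) auto
    qed (rule measurable_op_exp[OF \<phi> W])
    also have "\<dots> = (\<Sum>s\<in>S. (\<integral>\<omega>. f s \<omega> \<partial>M) * op_exp \<phi> (V s) $ k $ l)"
      using f by (subst Bochner_Integration.integral_sum) auto
    finally show ?thesis .
  qed
  then show ?thesis
    by (simp add: total_exp_def vec_eq_iff cscale_def)
qed

lemma mpow_mscale: "mpow (mscale c X) m = mscale (c ^ m) (mpow X m)"
  by (induction m) (simp_all add: mscale_mult mscale_simps mult.commute)

lemma mpow_sum:
  "mpow (\<Sum>l\<in>A. mscale (\<alpha> l) (U l)) m =
    (\<Sum>w | set w \<subseteq> A \<and> length w = m. mscale (\<Prod>l\<leftarrow>w. \<alpha> l) (foldr (**) (map U w) (mat 1)))"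
proof (induction m)
  case 0
  have "{w. set w \<subseteq> A \<and> length w = 0} = {[]}" by auto
  then show ?case by (simp add: mscale_simps)
next
  case (Suc m)
  let ?W = "{w. set w \<subseteq> A \<and> length w = m}"
  have inj: "inj_on (\<lambda>(w, l). l # w) (?W \<times> A)"
    by (auto simp: inj_on_def)
  have "(\<Sum>w | set w \<subseteq> A \<and> length w = Suc m. mscale (\<Prod>l\<leftarrow>w. \<alpha> l) (foldr (**) (map U w) (mat 1)))
      = (\<Sum>(w, l)\<in>?W \<times> A. mscale (\<alpha> l * (\<Prod>l\<leftarrow>w. \<alpha> l)) (U l ** foldr (**) (map U w) (mat 1)))"
    unfolding lists_length_Suc_eq by (subst sum.reindex[OF inj]) (simp add: case_prod_beta)
  also have "\<dots> = (\<Sum>w\<in>?W. \<Sum>l\<in>A. mscale (\<alpha> l * (\<Prod>l\<leftarrow>w. \<alpha> l)) (U l ** foldr (**) (map U w) (mat 1)))"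
    by (simp add: sum.cartesian_product)
  also have "\<dots> = (\<Sum>l\<in>A. mscale (\<alpha> l) (U l)) **
      (\<Sum>w\<in>?W. mscale (\<Prod>l\<leftarrow>w. \<alpha> l) (foldr (**) (map U w) (mat 1)))"
    by (simp add: matrix_mult_sum(1)) (simp add: matrix_mult_sum(2) mscale_mult mscale_simps mscale_sum mult.commute)
  finally show ?case
    by (simp add: Suc)
qed

text \<open>If \<open>\<Sum>\<^sub>i c\<^sub>i E(V\<^sub>i) = 0\<close>, the matrices \<open>V\<^sub>i\<close> may be replaced by their centrings although the individual \<open>E(V\<^sub>i)\<close>
need not vanish. Here the matrices \<open>E i\<close> take the place of \<open>E(V\<^sub>i)\<close>.\<close>

lemma sum_mscale_centred:
  assumes "\<And>k l. (\<Sum>i\<in>L. c i * E i $ k $ l) = 0"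
  shows "(\<Sum>i\<in>L. mscale (c i) (V i + membed (- E i))) = (\<Sum>i\<in>L. mscale (c i) (V i))"
proof -
  have "(\<Sum>i\<in>L. cscale (c i) (E i)) = 0"
    using assms by (simp add: vec_eq_iff cscale_def)
  moreover have "(\<Sum>i\<in>L. mscale (c i) (V i + membed (- E i))) + membed (\<Sum>i\<in>L. cscale (c i) (E i)) =
      (\<Sum>i\<in>L. mscale (c i) (V i))"
  proof -
    have m: "membed (\<Sum>i\<in>L. cscale (c i) (E i)) = (\<Sum>i\<in>L. mscale (c i) (membed (E i)))"
      by (induction L rule: infinite_finite_induct) (simp_all add: membed_simps)
    have cancel: "V i + membed (- E i) + membed (E i) = V i" for i
      using membed_uminus[of "E i"] by (simp add: add.assoc add.commute)
    then show ?thesis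
      unfolding m sum.distrib[symmetric] mscale_simps(1)[symmetric] cancel by simp
  qed
  ultimately show ?thesis
    by (simp add: membed_simps)
qed

section \<open>The central limit theorem\<close>

theorem theorem2:
  fixes M :: "'w measure" and \<phi> :: "'a::star_algebra \<Rightarrow> complex"
    and M' :: "'v measure" and \<phi>' :: "'b::star_algebra \<Rightarrow> complex"
    and Z :: "'w \<Rightarrow> 'a ^'d^'d" and Zs :: "nat \<Rightarrow> 'v \<Rightarrow> 'b ^'d^'d"
  assumes "prob_space M" and "star_prob_space \<phi>"
    and "prob_space M'" and "star_prob_space \<phi>'"
    and "Z \<in> random_op_matrices M"
    and "selfadjoint_rom M Z"
    and "centered_rom M \<phi> Z"
    and "indep_free_copies M \<phi> Z M' \<phi>' Zs"
  shows "\<forall>m::nat.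
    (\<lambda>N. total_exp M' \<phi>' (\<lambda>\<omega>. mpow (normalized_sum Zs N \<omega>) m)) \<longlonglongrightarrow>
    (\<Sum>\<pi>\<in>NC2 m. kappa (\<lambda>B. total_exp M \<phi> (\<lambda>\<omega>. Z \<omega> ** membed B ** Z \<omega>)) \<pi>)"
proof
  fix m :: nat
  interpret \<phi>: star_prob_space \<phi> by fact
  interpret M': prob_space M' by fact
  obtain n a X a' X' where a: "\<And>i. i \<in> {1..n} \<Longrightarrow> a i \<in> Linf_minus M"
    and Z: "teq M Z (tsum n a X)"
    and a': "\<And>j i. j \<in> {1..} \<Longrightarrow> i \<in> {1..n} \<Longrightarrow> a' j i \<in> Linf_minus M'"
    and Zs: "\<And>j. j \<ge> 1 \<Longrightarrow> Zs j \<in> random_op_matrices M'"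
      "\<And>j. j \<ge> 1 \<Longrightarrow> teq M' (Zs j) (tsum n (a' j) (X' j))"
    and indep: "M'.indep_vars (\<lambda>_. Pi\<^sub>M {1..n} (\<lambda>_. borel)) (\<lambda>j \<omega>. \<lambda>i\<in>{1..n}. a' j i \<omega>) {1..}"
    and coeff_distr: "\<And>j. j \<in> {1..} \<Longrightarrow>
      distr M' (Pi\<^sub>M {1..n} (\<lambda>_. borel)) (\<lambda>\<omega>. \<lambda>i\<in>{1..n}. a' j i \<omega>) =
      distr M (Pi\<^sub>M {1..n} (\<lambda>_. borel)) (\<lambda>\<omega>. \<lambda>i\<in>{1..n}. a i \<omega>)"
    and same: "\<And>j. j \<in> {1..} \<Longrightarrow> same_op_distr \<phi>' \<phi> {1..n} (X' j) X"
    and free: "free_families \<phi>' {1..} {1..n} X'"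
    using assms(8) unfolding indep_free_copies_def by (elim exE conjE) (rule that; auto)
  define L where "L = {1..n}"
  define p :: "nat \<Rightarrow> (complex ^'d^'d, nat) ncpoly"
    where "p = (\<lambda>i. subtract_coeff (op_exp \<phi> (X i)) (NVar i))"
  interpret word_moments M a L \<phi> X \<phi>' "{1..}" X' p
    by (rule word_moments.intro)
      (use assms(2,4) same free in \<open>simp_all add: L_def p_def \<phi>.op_exp_subtract_coeff\<close>)
  \<comment> \<open>\<open>Z\<close> has a representation by centred matrices, but the copies may come from another one. Comparing
    the two shows \<open>\<Sum>\<^sub>i a\<^sub>i E(X\<^sub>i) = E(Z) = 0\<close>, so the matrices \<open>X\<^sub>i\<close> may be centred one by one.\<close>
  have zero: "AE \<omega> in M. (\<Sum>i\<in>L. a i \<omega> * op_exp \<phi> (X i) $ k $ l) = 0" for k l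
  proof -
    obtain n0 a0 X0 where X0: "\<And>i. i \<in> {1..n0} \<Longrightarrow> op_exp \<phi> (X0 i) = 0" and Z0: "teq M Z (tsum n0 a0 X0)"
      using assms(7) unfolding centered_rom_def by blast
    from Z Z0 have "AE \<omega> in M. tsum n a X \<omega> = tsum n0 a0 X0 \<omega>"
      unfolding teq_def by eventually_elim simp
    then show ?thesis
    proof eventually_elim
      case (elim \<omega>)
      have "op_exp \<phi> (tsum n0 a0 X0 \<omega>) = 0"
        using X0 by (simp add: tsum_def \<phi>.op_exp_sum \<phi>.op_exp_mscale cscale_simps)
      then have "op_exp \<phi> (tsum n a X \<omega>) $ k $ l = 0"
        using elim by simp
      then show ?case
        by (simp add: tsum_def \<phi>.op_exp_sum \<phi>.op_exp_mscale cscale_def L_def)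
    qed
  qed
  have zero': "AE \<omega> in M'. (\<Sum>i\<in>L. a' j i \<omega> * op_exp \<phi> (X i) $ k $ l) = 0" if "j \<in> {1..}" for j k l
    by (rule AE_linear_relation_copies[where a = a and M = M])
      (use a a' coeff_distr zero that in \<open>auto simp: L_def Linf_minus_def\<close>)
  have all_zero: "AE \<omega> in M. \<forall>k l. (\<Sum>i\<in>L. a i \<omega> * op_exp \<phi> (X i) $ k $ l) = 0"
    by (intro eventually_all_finite zero)
  have all_zero': "AE \<omega> in M'. \<forall>k l. (\<Sum>i\<in>L. a' j i \<omega> * op_exp \<phi> (X i) $ k $ l) = 0"
    if "j \<in> {1..}" for j
    by (intro eventually_all_finite zero' that)
  have Z_centred: "AE \<omega> in M. Z \<omega> = (\<Sum>i\<in>L. mscale (a i \<omega>) (nceval X (p i)))"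
    using Z[unfolded teq_def] all_zero
    by eventually_elim (simp add: p_def subtract_coeff_def sum_mscale_centred tsum_def L_def)
  have Zs_centred: "AE \<omega> in M'. Zs j \<omega> = (\<Sum>i\<in>L. mscale (a' j i \<omega>) (nceval (X' j) (p i)))"
    if "j \<in> {1..}" for j
    using Zs(2)[unfolded teq_def, of j] all_zero'[OF that] that
    by (auto elim!: eventually_elim2 simp: p_def subtract_coeff_def sum_mscale_centred tsum_def L_def)
  have eta_total_exp: "total_exp M \<phi> (\<lambda>\<omega>. Z \<omega> ** membed B ** Z \<omega>) = eta B" for B
  proof -
    have "total_exp M \<phi> (\<lambda>\<omega>. Z \<omega> ** membed B ** Z \<omega>) =
        (\<Sum>s\<in>L \<times> L. cscale (\<integral>\<omega>. a (fst s) \<omega> * a (snd s) \<omega> \<partial>M)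
          (op_exp \<phi> (nceval X (p (fst s)) ** membed B ** nceval X (p (snd s)))))"
    proof (rule total_exp_sum[OF assms(2)])
      show "measurable_tensor M (\<lambda>\<omega>. Z \<omega> ** membed B ** Z \<omega>)"
        by (intro measurable_tensor_mult measurable_tensor_const
            measurable_tensor_random_op_matrix assms(5))
      show "AE \<omega> in M. Z \<omega> ** membed B ** Z \<omega> = (\<Sum>s\<in>L \<times> L. mscale (a (fst s) \<omega> * a (snd s) \<omega>)
          (nceval X (p (fst s)) ** membed B ** nceval X (p (snd s))))"
        using Z_centred
      proof eventually_elim
        case (elim \<omega>)
        show ?case
          unfolding elim
          by (simp add: matrix_mult_sum(2))
            (simp add: matrix_mult_sum(1) mscale_mult mscale_simps sum.cartesian_product
              case_prod_beta mult.commute)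
      qed
      show "integrable M (\<lambda>\<omega>. a (fst s) \<omega> * a (snd s) \<omega>)" if "s \<in> L \<times> L" for s
        using that by (intro Linf_minus_integrable Linf_minus_mult a) (auto simp: L_def)
    qed
    then show ?thesis
      by (simp add: eta_def cov_def block_moment_def sum.cartesian_product case_prod_beta)
  qed
  have "total_exp M' \<phi>' (\<lambda>\<omega>. mpow (normalized_sum Zs N \<omega>) m) =
      cscale (complex_of_real (1 / sqrt (real N)) ^ m) (\<Sum>w\<in>words {1..N} m. moment w)" for N
  proof -
    define c where "c = complex_of_real (1 / sqrt (real N))"
    have words_range: "set w \<subseteq> {1..} \<times> {1..n}" if "w \<in> words {1..N} m" for w
    proof -
      have "set w \<subseteq> {1..N} \<times> L"
        using that by (simp add: words_def)
      also have "\<dots> \<subseteq> {1..} \<times> {1..n}"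
        by (auto simp: L_def)
      finally show ?thesis .
    qed
    let ?\<alpha> = "\<lambda>l \<omega>. a' (fst l) (snd l) \<omega>"
    have "total_exp M' \<phi>' (\<lambda>\<omega>. mpow (normalized_sum Zs N \<omega>) m) =
        (\<Sum>w\<in>words {1..N} m. cscale (\<integral>\<omega>. c ^ m * (\<Prod>l\<leftarrow>w. ?\<alpha> l \<omega>) \<partial>M') (op_moment w))"
      unfolding op_moment_def
    proof (rule total_exp_sum[OF assms(4)])
      have "measurable_tensor M' (\<lambda>\<omega>. mscale c (mat 1) ** (\<Sum>j = 1..N. Zs j \<omega>))"
        by (intro measurable_tensor_mult measurable_tensor_const measurable_tensor_sum
            measurable_tensor_random_op_matrix Zs(1)) auto
      then show "measurable_tensor M' (\<lambda>\<omega>. mpow (normalized_sum Zs N \<omega>) m)"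
        by (intro measurable_tensor_mpow) (simp add: normalized_sum_def c_def mscale_mult)
      have "AE \<omega> in M'. \<forall>j\<in>{1..}. Zs j \<omega> = (\<Sum>i\<in>L. mscale (a' j i \<omega>) (nceval (X' j) (p i)))"
        using Zs_centred by (intro AE_ball_countable[THEN iffD2]) auto
      then show "AE \<omega> in M'. mpow (normalized_sum Zs N \<omega>) m =
          (\<Sum>w\<in>words {1..N} m. mscale (c ^ m * (\<Prod>l\<leftarrow>w. ?\<alpha> l \<omega>))
            (word_eval X' (map (map_prod id p) w)))"
      proof eventually_elim
        case (elim \<omega>)
        have "(\<Sum>j = 1..N. Zs j \<omega>) =
            (\<Sum>l\<in>{1..N} \<times> L. mscale (?\<alpha> l \<omega>) (nceval (X' (fst l)) (p (snd l))))"
          using elim by (simp add: sum.cartesian_product case_prod_beta)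
        then have "mpow (normalized_sum Zs N \<omega>) m = mscale (c ^ m)
            (\<Sum>w\<in>words {1..N} m. mscale (\<Prod>l\<leftarrow>w. ?\<alpha> l \<omega>)
              (foldr (**) (map (\<lambda>l. nceval (X' (fst l)) (p (snd l))) w) (mat 1)))"
          by (simp add: normalized_sum_def mpow_mscale mpow_sum words_def c_def)
        then show ?case
          by (simp add: mscale_sum mscale_simps word_eval_def case_prod_beta o_def)
      qed
      fix w assume "w \<in> words {1..N} m"
      note w = words_range[OF this]
      have "?\<alpha> l \<in> Linf_minus M'" if "l \<in> set w" for l
        by (rule a') (use w that in auto)
      then show "integrable M' (\<lambda>\<omega>. c ^ m * (\<Prod>l\<leftarrow>w. ?\<alpha> l \<omega>))"
        by (intro Linf_minus_integrable Linf_minus_mult_const M'.Linf_minus_prod_list)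
    qed
    also have "\<dots> = (\<Sum>w\<in>words {1..N} m. cscale (c ^ m) (moment w))"
    proof (rule sum.cong[OF refl])
      fix w assume "w \<in> words {1..N} m"
      note w = words_range[OF this]
      show "cscale (\<integral>\<omega>. c ^ m * (\<Prod>l\<leftarrow>w. ?\<alpha> l \<omega>) \<partial>M') (op_moment w) = cscale (c ^ m) (moment w)"
        using expectation_indep_copies[OF assms(3) a a' indep coeff_distr w]
        by (simp add: moment_def cscale_simps)
    qed
    finally show ?thesis
      by (simp add: cscale_sum c_def)
  qed
  moreover have "(\<lambda>N. cscale (complex_of_real (1 / sqrt (real N)) ^ m) (\<Sum>w\<in>words {1..N} m. moment w))
      \<longlonglongrightarrow> nc_sum eta m"
    by (rule sum_moment_words_limit) (auto simp: infinite_Ici)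
  moreover have "(\<Sum>\<pi>\<in>NC2 m. kappa eta \<pi>) = nc_sum eta m"
    by (rule sum_kappa_NC2) (rule eta_linear)
  ultimately show "(\<lambda>N. total_exp M' \<phi>' (\<lambda>\<omega>. mpow (normalized_sum Zs N \<omega>) m)) \<longlonglongrightarrow>
      (\<Sum>\<pi>\<in>NC2 m. kappa (\<lambda>B. total_exp M \<phi> (\<lambda>\<omega>. Z \<omega> ** membed B ** Z \<omega>)) \<pi>)"
    by (simp add: eta_total_exp)
qed

end
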